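(* Let $V$ be a vertex operator algebra, $g$ an automorphism of $V$ with $g^T=1$, $M^1$ an admissible untwisted $V$-module of conformal weight $h_1$, and $U^2$ (resp. $U^3$) a left (resp. right) $A_g(V)$-module on which $[\omega]$ acts as $h_2\,\mathrm{id}$ (resp. $h_3\,\mathrm{id}$). Put $h=h_1+h_2-h_3$. Let $\mathscr C(\Sigma_1(U^3,M^1,U^2))$ be the space of twisted restricted conformal blocks associated to $\Sigma_1(U^3,M^1,U^2)=(\mathbf x\colon\bar C\to\mathbb P^1,\infty,1,0,U^3,M^1,U^2)$, and let $\mathscr C(U^3,M^1,U^2)=((U^3\otimes M^1\otimes U^2)/J)^*$, where $J$ is the subspace of $U^3\otimes M^1\otimes U^2$ spanned by the elements $$u_3\otimes(L_{-1}+L_0-h_1+h)v\otimes u_2,$$ $$u_3\cdot[a]\otimes v\otimes u_2-\sum_{j\ge0}\binom{\mathrm{wt}\,a}ju_3\otimes a_{(j-1)}v\otimes u_2,\qquad a\in V^0,$$ $$u_3\otimes v\otimes[a]\cdot u_2-\sum_{j\ge0}\binom{\mathrm{wt}\,a-1}ju_3\otimes a_{(j-1)}v\otimes u_2,\qquad a\in V^0,$$ $$\sum_{j\ge0}\binom{\mathrm{wt}\,a-1+\frac rT}ju_3\otimes a_{(j-1)}v\otimes u_2,\qquad a\in V^r,\ r\ne0,$$ for $u_3\in U^3$, $v\in M^1$, $u_2\in U^2$ and homogeneous $a$. Then $\mathscr C(\Sigma_1(U^3,M^1,U^2))$ and $\mathscr C(U^3,M^1,U^2)$ coincide as subspaces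 of the space of linear functionals $(U^3\otimes M^1\otimes U^2)^*$.
   Context: Everything is over $\mathbb C$; $\mathbb N=\{0,1,2,\dots\}$. A vertex operator algebra $V=\bigoplus_{k\in\mathbb N}V_k$ is $\mathbb N$-graded with $\dim V_k<\infty$, has vertex operators $Y(a,z)=\sum_{n\in\mathbb Z}a_{(n)}z^{-n-1}$, vacuum $\mathbf 1\in V_0$, conformal vector $\omega\in V_2$ with $Y(\omega,z)=\sum L_nz^{-n-2}$, and satisfies the usual axioms; $\mathrm{wt}\,a=k$ for $a\in V_k$. For an automorphism $g$ (linear, fixing $\mathbf 1,\omega$, $gY(a,z)g^{-1}=Y(ga,z)$) with $g^T=1$, $V^r=V_g^r=\{a: ga=e^{2\pi ir/T}a\}$, $0\le r\le T-1$. An admissible untwisted module $M^1=\bigoplus_{n\in\mathbb N}M^1(n)$ satisfies $a_{(m)}M^1(n)\subset M^1(\mathrm{wt}\,a-m-1+n)$ and has conformal weight $h_1$ if $L_0=h_1+n$ on $M^1(n)$. With $\delta(0)=1$ and $\delta(r)=0$ for $r\ne0$, the $g$-twisted Zhu's algebra is $A_g(V)=V/O_g(V)$, with $O_g(V)$ spanned by $\mathrm{Res}_z\frac{(1+z)^{\mathrm{wt}\,a-1+\delta(r)+r/T}}{z^{1+\delta(r)}}Y(a,z)b$ for homogeneous $a\in V^r$, $b\in V$, and product $[a]*_g[b]=[\mathrm{Res}_zY(a,z)b\frac{(1+z)^{\mathrm{wt}\,a}}z]$ for $a\in V^0$, and $0$ for $a\in V^r$, $r\ne0$ (note $[a]=0$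 for $a\in V^r$, $r\ne0$). The twisted projective line $\mathbf x\colon\bar C\to\mathbb P^1$ is the cyclic cover $z=(z^{1/T})^T$ with branch points $0,\infty$ and Deck generators acting on $V$ as $g$ at $0$ and $g^{-1}$ at $\infty$. $U^3,M^1,U^2$ are attached to $\infty,1,0$; fibres are identified with the modules through the coordinates $z^{-1/T}$, $z-1$ (at the lift of $1$ where $z^{1/T}=1$) and $z^{1/T}$. The constrained Lie algebra $\mathcal L^\circ_{\mathbb P^1\setminus\{1\}}(\mathcal V^G)_{\le0}$ is the subalgebra of the twisted chiral Lie algebra $(V\otimes\mathbb C[z^{\pm1/T},(z-1)^{-1}]dz)^g/\mathrm{Im}(L_{-1}\otimes1+1\otimes\partial_z)$ (where $g(a\otimes z^{m/T})=e^{-2\pi im/T}ga\otimes z^{m/T}$ and $[a\otimes f\,dz,b\otimes f'dz]=\sum_{j\ge0}\frac1{j!}(a_{(j)}b)\otimes(\partial_z^jf)f'dz$) spanned by the classes of $\alpha=a\otimes\frac{z^{r/T+m}}{(z-1)^n}dz$ with $a\in V^r$ homogeneous, $m\in\mathbb Z$, $n\in\mathbb N$, $\frac rT+m-n\le\mathrm{wt}\,a-1\le\frac rT+m$. Such $\alpha$ acts on $U^3\otimes M^1\otimes U^2$ by the sum of: on $U^3$, $u_3\mapsto-u_3\cdot[a]$ if $\frac rT+m-n=\mathrm{wt}\,a-1$, and $0$ otherwise; on $M^1$, $\sum_{j\ge0}\binom{r/T+m}ja_{(j-n)}$; on $U^2$, $u_2\mapsto(-1)^n[a]\cdot u_2$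 if $\frac rT+m=\mathrm{wt}\,a-1$, and $0$ otherwise. $\mathscr C(\Sigma_1(U^3,M^1,U^2))$ is the space of linear functionals on $U^3\otimes M^1\otimes U^2$ vanishing on the image of this action. *)

theory Defs
  imports
    Complex_Main
    "HOL-Library.Groups_Big_Fun"
    "HOL-Library.Poly_Mapping"
    "HOL-Computational_Algebra.Formal_Laurent_Series"
begin

section \<open>Complex vector spaces\<close>

class complex_vector = ab_group_add +
  fixes scaleC :: "complex \<Rightarrow> 'a \<Rightarrow> 'a"  (infixr "*\<^sub>C" 75)
  assumes scaleC_add_right: "c *\<^sub>C (x + y) = c *\<^sub>C x + c *\<^sub>C y"
    and scaleC_add_left: "(c + d) *\<^sub>C x = c *\<^sub>C x + d *\<^sub>C x"
    and scaleC_scaleC: "c *\<^sub>C d *\<^sub>C x = (c * d) *\<^sub>C x"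
    and scaleC_one: "1 *\<^sub>C x = x"

global_interpretation cvs: vector_space "scaleC :: complex \<Rightarrow> 'a \<Rightarrow> 'a::complex_vector"
  defines csubspace = cvs.subspace and cspan = cvs.span
  by unfold_locales (simp_all add: scaleC_add_right scaleC_add_left scaleC_scaleC scaleC_one)

abbreviation clinear :: "('a::complex_vector \<Rightarrow> 'b::complex_vector) \<Rightarrow> bool" where
  "clinear \<equiv> Vector_Spaces.linear scaleC scaleC"

lemma clinear_iff:
  "clinear f \<longleftrightarrow> (\<forall>x y. f (x + y) = f x + f y) \<and> (\<forall>c x. f (c *\<^sub>C x) = c *\<^sub>C f x)"
  by (auto simp: Vector_Spaces.linear_def module_hom_def module_hom_axioms_def
      cvs.vector_space_axioms cvs.module_axioms)

definition cbilinear ::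
  "('a::complex_vector \<Rightarrow> 'b::complex_vector \<Rightarrow> 'c::complex_vector) \<Rightarrow> bool" where
  "cbilinear b \<longleftrightarrow> (\<forall>x. clinear (b x)) \<and> (\<forall>y. clinear (\<lambda>x. b x y))"

instantiation complex :: complex_vector
begin
definition scaleC_complex_def [simp]: "scaleC c (x::complex) = c * x"
instance by standard (simp_all add: algebra_simps)
end

instantiation poly_mapping :: (type, complex_vector) complex_vector
begin
definition scaleC_poly_mapping_def: "scaleC c p = Poly_Mapping.map (scaleC c) p"

lemma lookup_scaleC: "Poly_Mapping.lookup (c *\<^sub>C p) x = c *\<^sub>C Poly_Mapping.lookup p x"
  for p :: "'a \<Rightarrow>\<^sub>0 'b"
  by (simp add: scaleC_poly_mapping_def Poly_Mapping.map.rep_eq when_def cvs.scale_zero_right)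

instance
  by standard (auto intro!: poly_mapping_eqI simp: lookup_scaleC lookup_add
      scaleC_add_right scaleC_add_left scaleC_scaleC scaleC_one)
end

instantiation fls :: (complex_vector) complex_vector
begin
lift_definition scaleC_fls :: "complex \<Rightarrow> 'a fls \<Rightarrow> 'a fls" is "\<lambda>c f n. c *\<^sub>C f n"
  by (auto elim: eventually_mono simp: cvs.scale_zero_right)

instance
  by standard (transfer; auto simp: scaleC_add_right scaleC_add_left scaleC_scaleC scaleC_one)+
end

text \<open>The residue class \<open>x + W\<close>; as \<open>x\<close> varies, these are the elements of the quotient by \<open>W\<close>.\<close>

definition coset :: "'a::complex_vector set \<Rightarrow> 'a \<Rightarrow> 'a set" where
  "coset W x = {y. y - x \<in> W}"

text \<open>The dual of the quotient by \<open>W\<close>, embedded into the dual of the whole space by pull-back along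
  \<open>x \<mapsto> x + W\<close>. As this projection is linear and onto, a functional \<open>\<psi>\<close> on the quotient
  is linear precisely if its pull-back is.\<close>

definition quotient_dual :: "'a::complex_vector set \<Rightarrow> ('a \<Rightarrow> complex) set" where
  "quotient_dual W = {\<lambda>x. \<psi> (coset W x) |\<psi>. clinear (\<lambda>x. \<psi> (coset W x))}"


section \<open>Tensor products\<close>

abbreviation free_pair :: "'a \<Rightarrow> 'b \<Rightarrow> ('a \<times> 'b \<Rightarrow>\<^sub>0 complex)" where
  "free_pair x y \<equiv> Poly_Mapping.single (x, y) 1"

definition tensor_relations :: "('a::complex_vector \<times> 'b::complex_vector \<Rightarrow>\<^sub>0 complex) set" where
  "tensor_relations = cspan (
     {free_pair (x + x') y - (free_pair x y + free_pair x' y) |x x' y. True}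
   \<union> {free_pair x (y + y') - (free_pair x y + free_pair x y') |x y y'. True}
   \<union> {free_pair (c *\<^sub>C x) y - c *\<^sub>C free_pair x y |c x y. True}
   \<union> {free_pair x (c *\<^sub>C y) - c *\<^sub>C free_pair x y |c x y. True})"

definition tensor_rel ::
  "('a::complex_vector \<times> 'b::complex_vector \<Rightarrow>\<^sub>0 complex) \<Rightarrow> ('a \<times> 'b \<Rightarrow>\<^sub>0 complex) \<Rightarrow> bool" where
  "tensor_rel p q \<longleftrightarrow> p - q \<in> tensor_relations"

lemma tensor_relations_diff:
  "p \<in> tensor_relations \<Longrightarrow> q \<in> tensor_relations \<Longrightarrow> p - q \<in> tensor_relations"
  unfolding tensor_relations_def by (rule cvs.span_diff)

lemma tensor_relations_add:
  "p \<in> tensor_relations \<Longrightarrow> q \<in> tensor_relations \<Longrightarrow> p + q \<in> tensor_relations"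
  unfolding tensor_relations_def by (rule cvs.span_add)

lemma tensor_relations_scale:
  "p \<in> tensor_relations \<Longrightarrow> c *\<^sub>C p \<in> tensor_relations"
  unfolding tensor_relations_def by (rule cvs.span_scale)

lemma tensor_relations_zero: "0 \<in> tensor_relations"
  unfolding tensor_relations_def by (rule cvs.span_zero)

lemma equivp_tensor_rel:
  "equivp (tensor_rel :: ('a::complex_vector \<times> 'b::complex_vector \<Rightarrow>\<^sub>0 complex) \<Rightarrow> _)"
proof (rule equivpI)
  show "reflp (tensor_rel :: ('a \<times> 'b \<Rightarrow>\<^sub>0 complex) \<Rightarrow> _)"
    by (rule reflpI) (simp add: tensor_rel_def tensor_relations_zero)
  show "symp (tensor_rel :: ('a \<times> 'b \<Rightarrow>\<^sub>0 complex) \<Rightarrow> _)"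
  proof (rule sympI)
    fix p q :: "'a \<times> 'b \<Rightarrow>\<^sub>0 complex"
    assume "tensor_rel p q"
    then have "0 - (p - q) \<in> tensor_relations"
      unfolding tensor_rel_def by (rule tensor_relations_diff[OF tensor_relations_zero])
    then show "tensor_rel q p" by (simp add: tensor_rel_def)
  qed
  show "transp (tensor_rel :: ('a \<times> 'b \<Rightarrow>\<^sub>0 complex) \<Rightarrow> _)"
  proof (rule transpI)
    fix p q r :: "'a \<times> 'b \<Rightarrow>\<^sub>0 complex"
    assume "tensor_rel p q" "tensor_rel q r"
    then have "(p - q) + (q - r) \<in> tensor_relations"
      unfolding tensor_rel_def by (rule tensor_relations_add)
    then show "tensor_rel p r" by (simp add: tensor_rel_def)
  qed
qed

quotient_type (overloaded) ('a, 'b) tensor =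
  "'a::complex_vector \<times> 'b::complex_vector \<Rightarrow>\<^sub>0 complex" / tensor_rel
  by (rule equivp_tensor_rel)

instantiation tensor :: (complex_vector, complex_vector) complex_vector
begin

lift_definition zero_tensor :: "('a, 'b) tensor" is 0 .

lift_definition plus_tensor :: "('a, 'b) tensor \<Rightarrow> ('a, 'b) tensor \<Rightarrow> ('a, 'b) tensor" is "(+)"
proof -
  fix p p' q q' :: "'a \<times> 'b \<Rightarrow>\<^sub>0 complex"
  assume "tensor_rel p p'" "tensor_rel q q'"
  then have "(p - p') + (q - q') \<in> tensor_relations"
    unfolding tensor_rel_def by (rule tensor_relations_add)
  then show "tensor_rel (p + q) (p' + q')" by (simp add: tensor_rel_def add_diff_add)
qed

lift_definition minus_tensor :: "('a, 'b) tensor \<Rightarrow> ('a, 'b) tensor \<Rightarrow> ('a, 'b) tensor" is "(-)"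
proof -
  fix p p' q q' :: "'a \<times> 'b \<Rightarrow>\<^sub>0 complex"
  assume "tensor_rel p p'" "tensor_rel q q'"
  then have "(p - p') - (q - q') \<in> tensor_relations"
    unfolding tensor_rel_def by (rule tensor_relations_diff)
  moreover have "(p - p') - (q - q') = (p - q) - (p' - q')"
    by (simp only: diff_conv_add_uminus minus_add_distrib minus_minus add_ac)
  ultimately show "tensor_rel (p - q) (p' - q')" by (simp only: tensor_rel_def)
qed

lift_definition uminus_tensor :: "('a, 'b) tensor \<Rightarrow> ('a, 'b) tensor" is uminus
proof -
  fix p q :: "'a \<times> 'b \<Rightarrow>\<^sub>0 complex"
  assume "tensor_rel p q"
  then have "0 - (p - q) \<in> tensor_relations"
    unfolding tensor_rel_def by (rule tensor_relations_diff[OF tensor_relations_zero])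
  then show "tensor_rel (- p) (- q)" by (simp add: tensor_rel_def)
qed

lift_definition scaleC_tensor :: "complex \<Rightarrow> ('a, 'b) tensor \<Rightarrow> ('a, 'b) tensor" is scaleC
proof -
  fix c and p q :: "'a \<times> 'b \<Rightarrow>\<^sub>0 complex"
  assume "tensor_rel p q"
  then have "c *\<^sub>C (p - q) \<in> tensor_relations"
    unfolding tensor_rel_def by (rule tensor_relations_scale)
  then show "tensor_rel (c *\<^sub>C p) (c *\<^sub>C q)"
    by (simp add: tensor_rel_def cvs.scale_right_diff_distrib)
qed

instance
proof
  fix a b c :: "('a, 'b) tensor" and x y :: complex
  show "a + b + c = a + (b + c)"
    by transfer (simp add: tensor_rel_def tensor_relations_zero add.assoc)
  show "a + b = b + a"
    by transfer (simp add: tensor_rel_def tensor_relations_zero add.commute)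
  show "0 + a = a" and "- a + a = 0" and "a - b = a + - b"
    by (transfer, simp add: tensor_rel_def tensor_relations_zero)+
  show "x *\<^sub>C (a + b) = x *\<^sub>C a + x *\<^sub>C b"
    by transfer (simp add: tensor_rel_def tensor_relations_zero scaleC_add_right)
  show "(x + y) *\<^sub>C a = x *\<^sub>C a + y *\<^sub>C a"
    by transfer (simp add: tensor_rel_def tensor_relations_zero scaleC_add_left)
  show "x *\<^sub>C y *\<^sub>C a = (x * y) *\<^sub>C a"
    by transfer (simp add: tensor_rel_def tensor_relations_zero scaleC_scaleC)
  show "1 *\<^sub>C a = a"
    by transfer (simp add: tensor_rel_def tensor_relations_zero scaleC_one)
qed

end

lift_definition tensor_of :: "'a::complex_vector \<Rightarrow> 'b::complex_vector \<Rightarrow> ('a, 'b) tensor"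
    (infixl "\<otimes>\<^sub>C" 76)
  is free_pair .

lemma cbilinear_tensor_of: "cbilinear (\<otimes>\<^sub>C)"
  unfolding cbilinear_def clinear_iff
proof (intro conjI allI)
  fix x x' :: 'a and y y' :: 'b and c :: complex
  show "x \<otimes>\<^sub>C (y + y') = x \<otimes>\<^sub>C y + x \<otimes>\<^sub>C y'"
    by transfer (unfold tensor_rel_def tensor_relations_def, rule cvs.span_base, blast)
  show "(x + x') \<otimes>\<^sub>C y = x \<otimes>\<^sub>C y + x' \<otimes>\<^sub>C y"
    by transfer (unfold tensor_rel_def tensor_relations_def, rule cvs.span_base, blast)
  show "x \<otimes>\<^sub>C (c *\<^sub>C y) = c *\<^sub>C (x \<otimes>\<^sub>C y)"
    by transfer (unfold tensor_rel_def tensor_relations_def, rule cvs.span_base, blast)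
  show "(c *\<^sub>C x) \<otimes>\<^sub>C y = c *\<^sub>C (x \<otimes>\<^sub>C y)"
    by transfer (unfold tensor_rel_def tensor_relations_def, rule cvs.span_base, blast)
qed

text \<open>The linear map induced by a bilinear map \<open>b\<close>; it is meaningful only for bilinear \<open>b\<close>,
  where it does not depend on the chosen representative.\<close>

definition free_lift :: "('a \<Rightarrow> 'b \<Rightarrow> 'c::complex_vector) \<Rightarrow> ('a \<times> 'b \<Rightarrow>\<^sub>0 complex) \<Rightarrow> 'c" where
  "free_lift b p = (\<Sum>(x, y)\<in>Poly_Mapping.keys p. Poly_Mapping.lookup p (x, y) *\<^sub>C b x y)"

definition tensor_lift ::
  "('a::complex_vector \<Rightarrow> 'b::complex_vector \<Rightarrow> 'c::complex_vector) \<Rightarrow> ('a, 'b) tensor \<Rightarrow> 'c" where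
  "tensor_lift b t = free_lift b (rep_tensor t)"

lemma free_lift_superset:
  assumes "finite S" "Poly_Mapping.keys p \<subseteq> S"
  shows "free_lift b p = (\<Sum>(x, y)\<in>S. Poly_Mapping.lookup p (x, y) *\<^sub>C b x y)"
  unfolding free_lift_def
  by (rule sum.mono_neutral_left)
    (use assms in \<open>auto simp: in_keys_iff cvs.scale_zero_left\<close>)

lemma clinear_free_lift: "clinear (free_lift b)"
  unfolding clinear_iff
proof (intro conjI allI)
  fix p q :: "'a \<times> 'b \<Rightarrow>\<^sub>0 complex" and c :: complex
  let ?S = "Poly_Mapping.keys p \<union> Poly_Mapping.keys q"
  have "free_lift b (p + q) = (\<Sum>(x, y)\<in>?S. Poly_Mapping.lookup (p + q) (x, y) *\<^sub>C b x y)"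
    by (rule free_lift_superset) (use Poly_Mapping.keys_add[of p q] in auto)
  also have "\<dots> = (\<Sum>(x, y)\<in>?S. Poly_Mapping.lookup p (x, y) *\<^sub>C b x y) + (\<Sum>(x, y)\<in>?S. Poly_Mapping.lookup q (x, y) *\<^sub>C b x y)"
    by (simp add: lookup_add scaleC_add_left case_prod_unfold sum.distrib)
  also have "\<dots> = free_lift b p + free_lift b q"
    using free_lift_superset[of ?S p b] free_lift_superset[of ?S q b] by simp
  finally show "free_lift b (p + q) = free_lift b p + free_lift b q" .
  have "free_lift b (c *\<^sub>C p) = (\<Sum>(x, y)\<in>Poly_Mapping.keys p. Poly_Mapping.lookup (c *\<^sub>C p) (x, y) *\<^sub>C b x y)"
    by (rule free_lift_superset) (auto simp: in_keys_iff lookup_scaleC)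
  also have "\<dots> = c *\<^sub>C free_lift b p"
    by (simp add: free_lift_def lookup_scaleC cvs.scale_sum_right case_prod_unfold scaleC_scaleC)
  finally show "free_lift b (c *\<^sub>C p) = c *\<^sub>C free_lift b p" .
qed

lemma free_lift_single: "free_lift b (free_pair x y) = b x y"
  by (simp add: free_lift_def scaleC_one)

lemma free_lift_diff: "free_lift b (p - q) = free_lift b p - free_lift b q"
  using clinear_free_lift[of b] unfolding clinear_iff by (metis diff_add_cancel eq_diff_eq)

lemma free_lift_relations:
  assumes "cbilinear b" "p \<in> tensor_relations"
  shows "free_lift b p = 0"
  using assms(2) unfolding tensor_relations_def
proof (induction rule: cvs.span_induct_alt)
  case base
  then show ?case by (simp add: free_lift_def)
next
  case (step c q p)
  have lin: "free_lift b (p + q) = free_lift b p + free_lift b q"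
    "free_lift b (c *\<^sub>C p) = c *\<^sub>C free_lift b p" for p q c
    using clinear_free_lift[of b] unfolding clinear_iff by auto
  have "free_lift b q = 0"
    using step(1) assms(1) unfolding cbilinear_def clinear_iff
    by (auto simp: free_lift_diff lin free_lift_single)
  with step(2) show ?case by (simp add: lin cvs.scale_zero_right)
qed

lemma tensor_lift_abs:
  assumes "cbilinear b"
  shows "tensor_lift b (abs_tensor p) = free_lift b p"
proof -
  have "tensor_rel (rep_tensor (abs_tensor p)) p"
    by (rule Quotient_rep_abs[OF Quotient_tensor]) (rule equivp_reflp[OF equivp_tensor_rel])
  then have "free_lift b (rep_tensor (abs_tensor p) - p) = 0"
    unfolding tensor_rel_def by (rule free_lift_relations[OF assms])
  then show ?thesis by (simp add: tensor_lift_def free_lift_diff)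
qed

lemma tensor_lift_tensor_of: "cbilinear b \<Longrightarrow> tensor_lift b (x \<otimes>\<^sub>C y) = b x y"
  by (simp add: tensor_of.abs_eq tensor_lift_abs free_lift_single)

lemma clinear_tensor_lift:
  assumes "cbilinear b"
  shows "clinear (tensor_lift b)"
  unfolding clinear_iff
proof (intro conjI allI)
  fix s t :: "('a, 'b) tensor" and c :: complex
  obtain p q where "s = abs_tensor p" "t = abs_tensor q"
    by (metis Quotient_abs_rep[OF Quotient_tensor])
  then show "tensor_lift b (s + t) = tensor_lift b s + tensor_lift b t"
    and "tensor_lift b (c *\<^sub>C s) = c *\<^sub>C tensor_lift b s"
    using clinear_free_lift[of b] unfolding clinear_iff
    by (simp_all add: plus_tensor.abs_eq scaleC_tensor.abs_eq tensor_lift_abs[OF assms])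
qed

lemma cspan_tensors: "cspan {x \<otimes>\<^sub>C y |x y. True} = (UNIV :: ('a::complex_vector, 'b::complex_vector) tensor set)"
proof -
  have "abs_tensor p \<in> cspan {x \<otimes>\<^sub>C y |x y. True}" for p :: "'a \<times> 'b \<Rightarrow>\<^sub>0 complex"
  proof -
    have monom: "abs_tensor (Poly_Mapping.single k v) \<in> cspan {x \<otimes>\<^sub>C y |x y. True}"
      for k :: "'a \<times> 'b" and v :: complex
    proof -
      obtain x y where k: "k = (x, y)" by (cases k)
      have "Poly_Mapping.single k v = v *\<^sub>C free_pair x y"
        by (rule poly_mapping_eqI) (simp add: k lookup_scaleC lookup_single when_def)
      then have "abs_tensor (Poly_Mapping.single k v) = v *\<^sub>C (x \<otimes>\<^sub>C y)"
        by (simp add: tensor_of.abs_eq scaleC_tensor.abs_eq)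
      then show ?thesis by (metis (mono_tags, lifting) cvs.span_scale cvs.span_base mem_Collect_eq)
    qed
    have "abs_tensor (\<Sum>k\<in>S. Poly_Mapping.single k (Poly_Mapping.lookup p k))
        \<in> cspan {x \<otimes>\<^sub>C y |x y. True}" if "finite S" for S
      using that
    proof (induction S rule: finite_induct)
      case empty
      then show ?case by (simp add: zero_tensor.abs_eq[symmetric] cvs.span_zero)
    next
      case (insert k S)
      then have "abs_tensor (\<Sum>k\<in>insert k S. Poly_Mapping.single k (Poly_Mapping.lookup p k))
          = abs_tensor (Poly_Mapping.single k (Poly_Mapping.lookup p k))
            + abs_tensor (\<Sum>k\<in>S. Poly_Mapping.single k (Poly_Mapping.lookup p k))"
        by (simp add: plus_tensor.abs_eq)
      then show ?case
        using cvs.span_add[OF monom insert.IH] by (simp only:)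
    qed
    note span_sum = this
    have "(\<Sum>k\<in>Poly_Mapping.keys p. Poly_Mapping.single k (Poly_Mapping.lookup p k)) = p"
      by (rule poly_mapping_eqI) (simp add: lookup_sum lookup_single when_def in_keys_iff)
    with span_sum[OF Poly_Mapping.finite_keys[of p]] show ?thesis by (simp only:)
  qed
  from this[of "rep_tensor t" for t]
  show ?thesis unfolding Quotient_abs_rep[OF Quotient_tensor] by blast
qed

definition tensor_map :: "('a::complex_vector \<Rightarrow> 'c::complex_vector) \<Rightarrow>
    ('b::complex_vector \<Rightarrow> 'd::complex_vector) \<Rightarrow> ('a, 'b) tensor \<Rightarrow> ('c, 'd) tensor" where
  "tensor_map f f' = tensor_lift (\<lambda>x y. f x \<otimes>\<^sub>C f' y)"

lemma tensor_map_tensor_of: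
  fixes f :: "'a::complex_vector \<Rightarrow> 'c::complex_vector"
    and f' :: "'b::complex_vector \<Rightarrow> 'd::complex_vector"
  assumes "clinear f" "clinear f'"
  shows "tensor_map f f' (x \<otimes>\<^sub>C y) = f x \<otimes>\<^sub>C f' y"
proof -
  have "cbilinear (\<lambda>x y. f x \<otimes>\<^sub>C f' y)"
    using assms cbilinear_tensor_of[where ?'a = 'c and ?'b = 'd]
    unfolding cbilinear_def clinear_iff by simp
  then show ?thesis unfolding tensor_map_def by (rule tensor_lift_tensor_of)
qed


section \<open>Vertex operator algebras and their modules\<close>

text \<open>\<open>mode V a n\<close> is the operator \<open>a\<^sub>(\<^sub>n\<^sub>)\<close>.\<close>

record 'v voa =
  mode :: "'v \<Rightarrow> int \<Rightarrow> 'v \<Rightarrow> 'v"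
  vac :: 'v
  conf :: 'v
  wt_space :: "nat \<Rightarrow> 'v set"

record ('v, 'm) voa_module =
  act_mode :: "'v \<Rightarrow> int \<Rightarrow> 'm \<Rightarrow> 'm"
  deg_space :: "nat \<Rightarrow> 'm set"

definition direct_sum :: "(nat \<Rightarrow> 'a::complex_vector set) \<Rightarrow> bool" where
  "direct_sum W \<longleftrightarrow> (\<forall>k. csubspace (W k)) \<and>
     (\<forall>x. \<exists>!f. (\<forall>k. f k \<in> W k) \<and> finite {k. f k \<noteq> 0} \<and> x = Sum_any f)"

definition component :: "(nat \<Rightarrow> 'a::complex_vector set) \<Rightarrow> nat \<Rightarrow> 'a \<Rightarrow> 'a" where
  "component W k x = (THE f. (\<forall>k. f k \<in> W k) \<and> finite {k. f k \<noteq> 0} \<and> x = Sum_any f) k"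

text \<open>\<open>residue Y p n a v\<close> is \<open>Res\<^sub>z (1 + z)\<^sup>p z\<^sup>-\<^sup>n Y(a,z)v\<close>, using \<open>Res\<^sub>z z\<^sup>i Y(a,z) = a\<^sub>(\<^sub>i\<^sub>)\<close>
  and expanding \<open>(1 + z)\<^sup>p\<close> in nonnegative powers of \<open>z\<close>. \<^const>\<open>Sum_any\<close> sums the nonzero
  summands, of which there are finitely many by truncation.\<close>

definition residue ::
  "('v \<Rightarrow> int \<Rightarrow> 'm \<Rightarrow> 'm::complex_vector) \<Rightarrow> complex \<Rightarrow> int \<Rightarrow> 'v \<Rightarrow> 'm \<Rightarrow> 'm" where
  "residue Y p n a v = Sum_any (\<lambda>j::nat. (p gchoose j) *\<^sub>C Y a (int j - n) v)"

text \<open>Bilinearity, truncation, vacuum and the Jacobi identity in Borcherds' component form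
  (the two sums on its right-hand side are merged, so that it is finite term by term).\<close>

definition weak_module ::
  "('v::complex_vector, 'x) voa_scheme \<Rightarrow> ('v \<Rightarrow> int \<Rightarrow> 'm \<Rightarrow> 'm::complex_vector) \<Rightarrow> bool" where
  "weak_module V Y \<longleftrightarrow>
     (\<forall>n. cbilinear (\<lambda>a. Y a n)) \<and>
     (\<forall>a v. \<exists>N. \<forall>n\<ge>N. Y a n v = 0) \<and>
     (\<forall>n v. Y (vac V) n v = (if n = -1 then v else 0)) \<and>
     (\<forall>a b v (m::int) (n::int) (k::int).
        Sum_any (\<lambda>j::nat. ((of_int m :: complex) gchoose j) *\<^sub>C
            Y (mode V a (n + int j) b) (m + k - int j) v)
      = Sum_any (\<lambda>j::nat. ((-1) ^ j * ((of_int n :: complex) gchoose j)) *\<^sub>C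
            (Y a (m + n - int j) (Y b (k + int j) v)
             - ((-1) powi n) *\<^sub>C Y b (n + k - int j) (Y a (m + int j) v))))"

definition Lop ::
  "('v, 'x) voa_scheme \<Rightarrow> ('v \<Rightarrow> int \<Rightarrow> 'm \<Rightarrow> 'm) \<Rightarrow> int \<Rightarrow> 'm \<Rightarrow> 'm" where
  "Lop V Y n = Y (conf V) (n + 1)"

definition vertex_operator_algebra :: "('v::complex_vector, 'x) voa_scheme \<Rightarrow> bool" where
  "vertex_operator_algebra V \<longleftrightarrow>
     direct_sum (wt_space V) \<and>
     (\<forall>k. \<exists>B. finite B \<and> wt_space V k = cspan B) \<and>
     vac V \<in> wt_space V 0 \<and> conf V \<in> wt_space V 2 \<and>
     weak_module V (mode V) \<and>
     (\<forall>a. mode V a (-1) (vac V) = a \<and> (\<forall>n\<ge>0. mode V a n (vac V) = 0)) \<and>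
     (\<exists>c::complex. \<forall>m n v.
        Lop V (mode V) m (Lop V (mode V) n v) - Lop V (mode V) n (Lop V (mode V) m v)
        = of_int (m - n) *\<^sub>C Lop V (mode V) (m + n) v
          + (if m + n = 0 then (of_int (m ^ 3 - m) / 12 * c) *\<^sub>C v else 0)) \<and>
     (\<forall>k. \<forall>a\<in>wt_space V k. Lop V (mode V) 0 a = of_nat k *\<^sub>C a) \<and>
     (\<forall>a n v. mode V (Lop V (mode V) (-1) a) n v = - (of_int n *\<^sub>C mode V a (n - 1) v))"

definition voa_automorphism :: "('v::complex_vector, 'x) voa_scheme \<Rightarrow> ('v \<Rightarrow> 'v) \<Rightarrow> bool" where
  "voa_automorphism V g \<longleftrightarrow>
     clinear g \<and> bij g \<and> g (vac V) = vac V \<and> g (conf V) = conf V \<and>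
     (\<forall>a n b. g (mode V a n b) = mode V (g a) n (g b))"

definition admissible_module ::
  "('v::complex_vector, 'x) voa_scheme \<Rightarrow> ('v, 'm::complex_vector, 'y) voa_module_scheme \<Rightarrow> bool" where
  "admissible_module V M \<longleftrightarrow>
     weak_module V (act_mode M) \<and> direct_sum (deg_space M) \<and>
     (\<forall>k n m. \<forall>a\<in>wt_space V k. \<forall>v\<in>deg_space M n.
        let d = int k - m - 1 + int n in
        if 0 \<le> d then act_mode M a m v \<in> deg_space M (nat d) else act_mode M a m v = 0)"

definition has_conformal_weight ::
  "('v, 'x) voa_scheme \<Rightarrow> ('v, 'm::complex_vector, 'y) voa_module_scheme \<Rightarrow> complex \<Rightarrow> bool" where
  "has_conformal_weight V M h \<longleftrightarrow>
     (\<forall>n. \<forall>v\<in>deg_space M n. Lop V (act_mode M) 0 v = (h + of_nat n) *\<^sub>C v)"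


section \<open>The twisted Zhu algebra and its modules\<close>

definition eigenspace :: "('v::complex_vector \<Rightarrow> 'v) \<Rightarrow> nat \<Rightarrow> nat \<Rightarrow> 'v set" where
  "eigenspace g T r = {a. g a = cis (2 * pi * real r / real T) *\<^sub>C a}"

definition zhu_O :: "('v::complex_vector, 'x) voa_scheme \<Rightarrow> ('v \<Rightarrow> 'v) \<Rightarrow> nat \<Rightarrow> 'v set" where
  "zhu_O V g T = cspan
     {residue (mode V) (of_nat k - 1 + (if r = 0 then 1 else 0) + of_nat r / of_nat T)
        (1 + (if r = 0 then 1 else 0)) a b
      |k r a b. r < T \<and> a \<in> wt_space V k \<and> a \<in> eigenspace g T r}"

abbreviation zhu_class ::
  "('v::complex_vector, 'x) voa_scheme \<Rightarrow> ('v \<Rightarrow> 'v) \<Rightarrow> nat \<Rightarrow> 'v \<Rightarrow> 'v set" where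
  "zhu_class V g T \<equiv> coset (zhu_O V g T)"

text \<open>The projection onto the fixed points of \<open>g\<close> along the other eigenspaces.\<close>

definition fixed_part :: "('v::complex_vector \<Rightarrow> 'v) \<Rightarrow> nat \<Rightarrow> 'v \<Rightarrow> 'v" where
  "fixed_part g T a = (1 / of_nat T) *\<^sub>C (\<Sum>i<T. (g ^^ i) a)"

text \<open>The bilinear product on \<open>V\<close> which for homogeneous \<open>a\<close> is \<open>Res\<^sub>z Y(a,z)b (1 + z)\<^bsup>wt a\<^esup> / z\<close> if
  \<open>a\<close> is fixed by \<open>g\<close>, and \<open>0\<close> if \<open>a\<close> lies in another eigenspace. The product of the twisted
  Zhu algebra is \<open>[a] * [b] = [zhu_star a b]\<close>.\<close>

definition zhu_star ::
  "('v::complex_vector, 'x) voa_scheme \<Rightarrow> ('v \<Rightarrow> 'v) \<Rightarrow> nat \<Rightarrow> 'v \<Rightarrow> 'v \<Rightarrow> 'v" where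
  "zhu_star V g T a b =
     Sum_any (\<lambda>k. residue (mode V) (of_nat k) 1 (component (wt_space V) k (fixed_part g T a)) b)"

definition left_zhu_module ::
  "('v::complex_vector, 'x) voa_scheme \<Rightarrow> ('v \<Rightarrow> 'v) \<Rightarrow> nat \<Rightarrow> ('v set \<Rightarrow> 'u \<Rightarrow> 'u::complex_vector) \<Rightarrow> bool" where
  "left_zhu_module V g T lact \<longleftrightarrow>
     cbilinear (\<lambda>a. lact (zhu_class V g T a)) \<and>
     (\<forall>u. lact (zhu_class V g T (vac V)) u = u) \<and>
     (\<forall>a b u. lact (zhu_class V g T (zhu_star V g T a b)) u
            = lact (zhu_class V g T a) (lact (zhu_class V g T b) u))"

definition right_zhu_module ::
  "('v::complex_vector, 'x) voa_scheme \<Rightarrow> ('v \<Rightarrow> 'v) \<Rightarrow> nat \<Rightarrow> ('u \<Rightarrow> 'v set \<Rightarrow> 'u::complex_vector) \<Rightarrow> bool" where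
  "right_zhu_module V g T ract \<longleftrightarrow>
     cbilinear (\<lambda>u a. ract u (zhu_class V g T a)) \<and>
     (\<forall>u. ract u (zhu_class V g T (vac V)) = u) \<and>
     (\<forall>a b u. ract u (zhu_class V g T (zhu_star V g T a b))
            = ract (ract u (zhu_class V g T a)) (zhu_class V g T b))"


section \<open>The twisted chiral Lie algebra and restricted conformal blocks\<close>

text \<open>Functions on the cyclic cover are elements of \<open>\<complex>[z\<^bsup>\<plusminus>1/T\<^esup>, (z - 1)\<^sup>-\<^sup>1]\<close>, embedded into the field of
  formal Laurent series in \<open>w = z\<^bsup>1/T\<^esup>\<close> by expansion at \<open>w = 0\<close>; so \<open>z = w\<^sup>T\<close>.\<close>

definition cover_fun :: "nat \<Rightarrow> int \<Rightarrow> nat \<Rightarrow> complex fls" where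
  "cover_fun T i n = fls_X_intpow i * inverse (fls_X ^ T - 1) ^ n"

definition cover_ring :: "nat \<Rightarrow> complex fls set" where
  "cover_ring T = cspan {cover_fun T i n |i n. True}"

text \<open>\<open>\<partial>\<^sub>z = (T w\<^bsup>T-1\<^esup>)\<^sup>-\<^sup>1 \<partial>\<^sub>w\<close>\<close>

definition deriv_z :: "nat \<Rightarrow> complex fls \<Rightarrow> complex fls" where
  "deriv_z T f = fls_deriv f / (of_nat T * fls_X ^ (T - 1))"

text \<open>\<open>f(w) \<mapsto> f(e\<^bsup>-2\<pi>i/T\<^esup> w)\<close>\<close>

definition deck_rotation :: "nat \<Rightarrow> complex fls \<Rightarrow> complex fls" where
  "deck_rotation T f = Abs_fls (\<lambda>n. cis (- 2 * pi * of_int n / real T) * fls_nth f n)"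

text \<open>A one-form \<open>a \<otimes> f dz\<close> is represented by \<open>a \<otimes> f\<close>; \<open>dz\<close> is invariant under the deck group.\<close>

definition invariant_forms :: "('v::complex_vector \<Rightarrow> 'v) \<Rightarrow> nat \<Rightarrow> ('v, complex fls) tensor set" where
  "invariant_forms g T =
     {x \<in> cspan {a \<otimes>\<^sub>C f |a f. f \<in> cover_ring T}. tensor_map g (deck_rotation T) x = x}"

definition nabla_image ::
  "('v::complex_vector, 'x) voa_scheme \<Rightarrow> ('v \<Rightarrow> 'v) \<Rightarrow> nat \<Rightarrow> ('v, complex fls) tensor set" where
  "nabla_image V g T =
     (\<lambda>x. tensor_map (Lop V (mode V) (-1)) id x + tensor_map id (deriv_z T) x) ` invariant_forms g T"

text \<open>The underlying space of the twisted chiral Lie algebra. Its bracket plays no role below, since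
  the space of conformal blocks depends only on the operators by which the elements act.\<close>

definition chiral_space ::
  "('v::complex_vector, 'x) voa_scheme \<Rightarrow> ('v \<Rightarrow> 'v) \<Rightarrow> nat \<Rightarrow> ('v, complex fls) tensor set set" where
  "chiral_space V g T = coset (nabla_image V g T) ` invariant_forms g T"

text \<open>The index \<open>(k, r, m, n)\<close> stands for the form \<open>a \<otimes> z\<^bsup>r/T+m\<^esup> (z - 1)\<^bsup>-n\<^esup> dz\<close> with \<open>a\<close> of weight \<open>k\<close>.\<close>

definition constrained ::
  "('v::complex_vector, 'x) voa_scheme \<Rightarrow> ('v \<Rightarrow> 'v) \<Rightarrow> nat \<Rightarrow> 'v \<Rightarrow> nat \<Rightarrow> nat \<Rightarrow> int \<Rightarrow> nat \<Rightarrow> bool" where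
  "constrained V g T a k r m n \<longleftrightarrow>
     r < T \<and> a \<in> wt_space V k \<and> a \<in> eigenspace g T r \<and>
     real r / real T + of_int m - real n \<le> real k - 1 \<and>
     real k - 1 \<le> real r / real T + of_int m"

definition form :: "nat \<Rightarrow> 'v::complex_vector \<Rightarrow> nat \<Rightarrow> int \<Rightarrow> nat \<Rightarrow> ('v, complex fls) tensor" where
  "form T a r m n = a \<otimes>\<^sub>C cover_fun T (int r + m * int T) n"

definition constrained_space ::
  "('v::complex_vector, 'x) voa_scheme \<Rightarrow> ('v \<Rightarrow> 'v) \<Rightarrow> nat \<Rightarrow> ('v, complex fls) tensor set set" where
  "constrained_space V g T = coset (nabla_image V g T) `
     cspan {form T a r m n |a k r m n. constrained V g T a k r m n}"

lemma cover_fun_support: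
  assumes "T \<ge> 1" "fls_nth (cover_fun T i n) j \<noteq> 0"
  shows "int T dvd j - i"
proof -
  define h :: "complex fls" where "h = inverse (fls_X ^ T - 1)"
  have ne: "fls_X ^ T - 1 \<noteq> (0 :: complex fls)"
  proof
    assume "fls_X ^ T - 1 = (0 :: complex fls)"
    then have "fls_nth (fls_X ^ T - 1 :: complex fls) 0 = 0" by simp
    then show False using assms(1) by (simp add: fls_X_power_conv_shift_1)
  qed
  have "(fls_X ^ T - 1) * h = 1" unfolding h_def using ne by simp
  then have "fls_shift (- int T) h - h = 1"
    by (simp add: left_diff_distrib fls_X_power_times_conv_shift)
  then have rec: "fls_nth h (k - int T) - fls_nth h k = (if k = 0 then 1 else 0)" for k
    by (metis fls_minus_nth fls_one_nth fls_shift_nth uminus_add_conv_diff add.commute)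
  have h0: "int T dvd k" if "fls_nth h k \<noteq> 0" for k
    using that
  proof (induction "nat (k - fls_subdegree h)" arbitrary: k rule: less_induct)
    case less
    show ?case
    proof (cases "k = 0")
      case False
      with rec[of k] less.prems have nz: "fls_nth h (k - int T) \<noteq> 0" by simp
      then have "fls_subdegree h \<le> k - int T"
        by (meson fls_eq0_below_subdegree not_le_imp_less)
      with assms(1) less.hyps[OF _ nz] have "int T dvd k - int T" by simp
      then show ?thesis by (metis dvd_diffD1 dvd_refl dvd_add_right_iff diff_add_cancel dvd_add)
    qed simp
  qed
  have "int T dvd k" if "fls_nth (h ^ n) k \<noteq> 0" for k
    using that
  proof (induction n arbitrary: k)
    case 0
    then show ?case by (simp split: if_splits)
  next
    case (Suc n)
    from Suc.prems have "\<exists>l. fls_nth h l * fls_nth (h ^ n) (k - l) \<noteq> 0"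
      unfolding power_Suc fls_times_nth(2) by (meson sum.not_neutral_contains_not_neutral)
    then obtain l where "fls_nth h l \<noteq> 0" "fls_nth (h ^ n) (k - l) \<noteq> 0" by auto
    then have "int T dvd l" "int T dvd k - l" using h0 Suc.IH by auto
    then show ?case by (metis dvd_add diff_add_cancel)
  qed
  moreover have "fls_nth (h ^ n) (j - i) \<noteq> 0"
    using assms(2) by (simp add: cover_fun_def h_def fls_X_intpow_times_conv_shift)
  ultimately show ?thesis by blast
qed

lemma deck_rotation_nth:
  "fls_nth (deck_rotation T f) n = cis (- 2 * pi * of_int n / real T) * fls_nth f n"
  unfolding deck_rotation_def
  by (rule nth_Abs_fls_lower_bound[of "fls_subdegree f"]) simp

lemma clinear_deck_rotation: "clinear (deck_rotation T)"
  unfolding clinear_iff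
  by (auto intro!: fls_eqI simp: deck_rotation_nth scaleC_fls.rep_eq algebra_simps)

lemma deck_rotation_cover_fun:
  assumes "T \<ge> 1"
  shows "deck_rotation T (cover_fun T i n) = cis (- 2 * pi * of_int i / real T) *\<^sub>C cover_fun T i n"
proof (rule fls_eqI)
  fix j
  show "fls_nth (deck_rotation T (cover_fun T i n)) j
      = fls_nth (cis (- 2 * pi * of_int i / real T) *\<^sub>C cover_fun T i n) j"
  proof (cases "fls_nth (cover_fun T i n) j = 0")
    case False
    then obtain q where q: "j = i + int T * q"
      using cover_fun_support[OF assms] by (metis add.commute diff_add_cancel dvdE)
    have "- 2 * pi * of_int j / real T = - 2 * pi * of_int i / real T + 2 * pi * of_int (- q)"
      using assms by (simp add: q field_simps)
    then have "cis (- 2 * pi * of_int j / real T)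
        = cis (- 2 * pi * of_int i / real T) * cis (2 * pi * of_int (- q))"
      by (simp only: cis_mult)
    moreover have "cis (2 * pi * of_int (- q)) = 1" by (rule cis_multiple_2pi) simp
    ultimately show ?thesis by (simp add: deck_rotation_nth scaleC_fls.rep_eq)
  qed (simp add: deck_rotation_nth scaleC_fls.rep_eq)
qed

lemma constrained_space_subset:
  assumes "clinear g" "T \<ge> 1"
  shows "constrained_space V g T \<subseteq> chiral_space V g T"
proof -
  have "form T a r m n \<in> invariant_forms g T" if "constrained V g T a k r m n" for a k r m n
  proof -
    let ?i = "int r + m * int T" and ?z = "cis (2 * pi * real r / real T)"
    have "- 2 * pi * of_int ?i / real T = - (2 * pi * real r / real T) + 2 * pi * of_int (- m)"
      using assms(2) by (simp add: field_simps)
    then have "cis (- 2 * pi * of_int ?i / real T)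
        = cis (- (2 * pi * real r / real T)) * cis (2 * pi * of_int (- m))"
      by (simp only: cis_mult)
    moreover have "cis (2 * pi * of_int (- m)) = 1" by (rule cis_multiple_2pi) simp
    ultimately have z: "cis (- 2 * pi * of_int ?i / real T) = inverse ?z"
      by simp
    have g: "g a = ?z *\<^sub>C a" using that by (simp add: constrained_def eigenspace_def)
    have bil: "(c *\<^sub>C x) \<otimes>\<^sub>C (d *\<^sub>C y) = (c * d) *\<^sub>C (x \<otimes>\<^sub>C y)"
      for c d and x :: 'a and y :: "complex fls"
      using cbilinear_tensor_of[where ?'a = 'a and ?'b = "complex fls"]
      unfolding cbilinear_def clinear_iff by (simp add: scaleC_scaleC)
    have "tensor_map g (deck_rotation T) (form T a r m n)
        = (?z *\<^sub>C a) \<otimes>\<^sub>C (inverse ?z *\<^sub>C cover_fun T ?i n)"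
      unfolding form_def tensor_map_tensor_of[OF assms(1) clinear_deck_rotation]
        deck_rotation_cover_fun[OF assms(2)] g z ..
    also have "\<dots> = form T a r m n" by (simp only: bil form_def) (simp add: scaleC_one cis_mult)
    finally have "tensor_map g (deck_rotation T) (form T a r m n) = form T a r m n" .
    moreover have "form T a r m n \<in> cspan {a \<otimes>\<^sub>C f |a f. f \<in> cover_ring T}"
      unfolding form_def cover_ring_def by (intro cvs.span_base) (auto intro!: cvs.span_base)
    ultimately show ?thesis by (simp add: invariant_forms_def)
  qed
  moreover have "csubspace (invariant_forms g T)"
  proof -
    have lin: "clinear (tensor_map g (deck_rotation T))"
      unfolding tensor_map_def
    proof (rule clinear_tensor_lift)
      show "cbilinear (\<lambda>x y. g x \<otimes>\<^sub>C deck_rotation T y)"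
        using assms(1) clinear_deck_rotation[of T]
          cbilinear_tensor_of[where ?'a = 'a and ?'b = "complex fls"]
        unfolding cbilinear_def clinear_iff by simp
    qed
    then have "tensor_map g (deck_rotation T) 0 = 0"
      unfolding clinear_iff by (metis add_cancel_right_right)
    with lin show ?thesis
      unfolding invariant_forms_def cvs.subspace_def clinear_iff
      by (auto simp: cvs.span_zero cvs.span_add cvs.span_scale)
  qed
  ultimately have "cspan {form T a r m n |a k r m n. constrained V g T a k r m n} \<subseteq> invariant_forms g T"
    by (intro cvs.span_minimal) auto
  then show ?thesis unfolding constrained_space_def chiral_space_def by (rule image_mono)
qed

text \<open>Triple tensor products are \<open>(U\<^sup>3 \<otimes> M\<^sup>1) \<otimes> U\<^sup>2\<close>.\<close>

definition form_action ::
  "('v::complex_vector, 'x) voa_scheme \<Rightarrow> ('v \<Rightarrow> 'v) \<Rightarrow> nat \<Rightarrow> ('v, 'm::complex_vector, 'y) voa_module_scheme \<Rightarrow>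
   ('u3 \<Rightarrow> 'v set \<Rightarrow> 'u3::complex_vector) \<Rightarrow> ('v set \<Rightarrow> 'u2 \<Rightarrow> 'u2::complex_vector) \<Rightarrow>
   'v \<Rightarrow> nat \<Rightarrow> nat \<Rightarrow> int \<Rightarrow> nat \<Rightarrow>
   (('u3, 'm) tensor, 'u2) tensor \<Rightarrow> (('u3, 'm) tensor, 'u2) tensor" where
  "form_action V g T M ract lact a k r m n t =
     (let s = real r / real T + of_int m;
          at_infinity = (\<lambda>u3. if s - real n = real k - 1 then - ract u3 (zhu_class V g T a) else 0);
          at_one = residue (act_mode M) (complex_of_real s) (int n) a;
          at_zero = (\<lambda>u2. if s = real k - 1 then (-1) ^ n *\<^sub>C lact (zhu_class V g T a) u2 else 0)
      in tensor_map (tensor_map at_infinity id) id t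
         + tensor_map (tensor_map id at_one) id t
         + tensor_map (tensor_map id id) at_zero t)"

text \<open>The graph of the action: the pairs of a constrained form and its operator, closed under linear
  combinations. A relation is used so that the definition does not presuppose that the action
  descends to residue classes.\<close>

inductive acts_as ::
  "('v::complex_vector, 'x) voa_scheme \<Rightarrow> ('v \<Rightarrow> 'v) \<Rightarrow> nat \<Rightarrow> ('v, 'm::complex_vector, 'y) voa_module_scheme \<Rightarrow>
   ('u3 \<Rightarrow> 'v set \<Rightarrow> 'u3::complex_vector) \<Rightarrow> ('v set \<Rightarrow> 'u2 \<Rightarrow> 'u2::complex_vector) \<Rightarrow>
   ('v, complex fls) tensor \<Rightarrow>
   ((('u3, 'm) tensor, 'u2) tensor \<Rightarrow> (('u3, 'm) tensor, 'u2) tensor) \<Rightarrow> bool"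
  for V g T M ract lact where
  generator: "constrained V g T a k r m n \<Longrightarrow>
    acts_as V g T M ract lact (form T a r m n) (form_action V g T M ract lact a k r m n)"
| zero: "acts_as V g T M ract lact 0 (\<lambda>t. 0)"
| add: "acts_as V g T M ract lact x F \<Longrightarrow> acts_as V g T M ract lact y G \<Longrightarrow>
    acts_as V g T M ract lact (x + y) (\<lambda>t. F t + G t)"
| scale: "acts_as V g T M ract lact x F \<Longrightarrow> acts_as V g T M ract lact (c *\<^sub>C x) (\<lambda>t. c *\<^sub>C F t)"

definition action_image ::
  "('v::complex_vector, 'x) voa_scheme \<Rightarrow> ('v \<Rightarrow> 'v) \<Rightarrow> nat \<Rightarrow> ('v, 'm::complex_vector, 'y) voa_module_scheme \<Rightarrow>
   ('u3 \<Rightarrow> 'v set \<Rightarrow> 'u3::complex_vector) \<Rightarrow> ('v set \<Rightarrow> 'u2 \<Rightarrow> 'u2::complex_vector) \<Rightarrow>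
   (('u3, 'm) tensor, 'u2) tensor set" where
  "action_image V g T M ract lact = cspan
     {F t |X x F t. X \<in> constrained_space V g T \<and> x \<in> X \<and> acts_as V g T M ract lact x F}"

definition restricted_conformal_blocks ::
  "('v::complex_vector, 'x) voa_scheme \<Rightarrow> ('v \<Rightarrow> 'v) \<Rightarrow> nat \<Rightarrow> ('v, 'm::complex_vector, 'y) voa_module_scheme \<Rightarrow>
   ('u3 \<Rightarrow> 'v set \<Rightarrow> 'u3::complex_vector) \<Rightarrow> ('v set \<Rightarrow> 'u2 \<Rightarrow> 'u2::complex_vector) \<Rightarrow>
   ((('u3, 'm) tensor, 'u2) tensor \<Rightarrow> complex) set" where
  "restricted_conformal_blocks V g T M ract lact =
     {\<phi>. clinear \<phi> \<and> (\<forall>t\<in>action_image V g T M ract lact. \<phi> t = 0)}"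


section \<open>The space of coinvariants\<close>

definition J_space ::
  "('v::complex_vector, 'x) voa_scheme \<Rightarrow> ('v \<Rightarrow> 'v) \<Rightarrow> nat \<Rightarrow> ('v, 'm::complex_vector, 'y) voa_module_scheme \<Rightarrow>
   ('u3 \<Rightarrow> 'v set \<Rightarrow> 'u3::complex_vector) \<Rightarrow> ('v set \<Rightarrow> 'u2 \<Rightarrow> 'u2::complex_vector) \<Rightarrow>
   complex \<Rightarrow> complex \<Rightarrow> (('u3, 'm) tensor, 'u2) tensor set" where
  "J_space V g T M ract lact h1 h =
     (let Y = act_mode M; L = Lop V Y; cls = zhu_class V g T in cspan (
        {u3 \<otimes>\<^sub>C (L (-1) v + L 0 v - h1 *\<^sub>C v + h *\<^sub>C v) \<otimes>\<^sub>C u2 |u3 v u2. True}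
      \<union> {ract u3 (cls a) \<otimes>\<^sub>C v \<otimes>\<^sub>C u2
          - Sum_any (\<lambda>j::nat. ((of_nat k :: complex) gchoose j) *\<^sub>C (u3 \<otimes>\<^sub>C Y a (int j - 1) v \<otimes>\<^sub>C u2))
          |u3 v u2 a k. a \<in> wt_space V k \<and> a \<in> eigenspace g T 0}
      \<union> {u3 \<otimes>\<^sub>C v \<otimes>\<^sub>C lact (cls a) u2
          - Sum_any (\<lambda>j::nat. ((of_nat k - 1 :: complex) gchoose j) *\<^sub>C (u3 \<otimes>\<^sub>C Y a (int j - 1) v \<otimes>\<^sub>C u2))
          |u3 v u2 a k. a \<in> wt_space V k \<and> a \<in> eigenspace g T 0}
      \<union> {Sum_any (\<lambda>j::nat. ((of_nat k - 1 + of_nat r / of_nat T :: complex) gchoose j) *\<^sub>C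
            (u3 \<otimes>\<^sub>C Y a (int j - 1) v \<otimes>\<^sub>C u2))
          |u3 v u2 a k r. r \<noteq> 0 \<and> r < T \<and> a \<in> wt_space V k \<and> a \<in> eigenspace g T r}))"

end

theory Submission
  imports Defs
begin

text \<open>Evaluating a functional on pure tensors \<open>u\<^sub>3 \<otimes> v \<otimes> u\<^sub>2\<close> turns both spaces into conditions on
  the numbers \<open>R p n a\<close>, the values of the functional at \<open>u\<^sub>3 \<otimes> Res\<^sub>z (1 + z)\<^sup>p z\<^sup>-\<^sup>n Y(a,z)v \<otimes> u\<^sub>2\<close>.
  The relations defining \<open>J\<close> are the constrained ones with \<open>n = 1\<close>, together with the one for
  \<open>\<omega> \<otimes> z dz\<close>. Conversely, \<open>(1 + z)\<^sup>p\<^sup>+\<^sup>1 = (1 + z)\<^sup>p + z (1 + z)\<^sup>p\<close> reduces a constrained relation to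
  the lowest admissible exponent \<open>p = wt a - 1 + r/T\<close>; there, integrating the relation for
  \<open>L\<^sub>-\<^sub>1 a\<close> by parts raises the order \<open>n\<close> of the pole, because \<open>[L\<^sub>-\<^sub>1 a] = - wt a [a]\<close> in the twisted
  Zhu algebra.\<close>

section \<open>Linear algebra\<close>

lemma clinear_module_hom: "clinear f \<Longrightarrow> module_hom scaleC scaleC f"
  by (simp add: linear_iff_module_hom)

lemmas clinear_zero = module_hom.zero[OF clinear_module_hom]
  and clinear_add = module_hom.add[OF clinear_module_hom]
  and clinear_scale = module_hom.scale[OF clinear_module_hom]
  and clinear_neg = module_hom.neg[OF clinear_module_hom]
  and clinear_diff = module_hom.diff[OF clinear_module_hom]
  and clinear_sum = module_hom.sum[OF clinear_module_hom]

text \<open>\<open>Sum_any\<close> is 0 on infinite support, so a linear map commutes with it only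
  once the support of \<open>x\<close> is known to be finite.\<close>

lemma clinear_Sum_any:
  assumes "clinear f" "finite {i. x i \<noteq> 0}"
  shows "f (Sum_any x) = Sum_any (\<lambda>i. f (x i))"
proof -
  have "Sum_any (\<lambda>i. f (x i)) = (\<Sum>i\<in>{i. x i \<noteq> 0}. f (x i))"
    by (rule Sum_any.expand_superset) (use assms clinear_zero[OF assms(1)] in auto)
  then show ?thesis
    by (simp add: Sum_any.expand_set clinear_sum[OF assms(1)])
qed

lemma clinear_zero_on_span:
  assumes "clinear \<phi>" "\<And>x. x \<in> S \<Longrightarrow> \<phi> x = 0" "x \<in> cspan S"
  shows "\<phi> x = 0"
  using assms(3)
proof (induction rule: cvs.span_induct_alt)
  case base
  show ?case by (rule clinear_zero[OF assms(1)])
next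
  case (step c x y)
  then show ?case by (simp add: clinear_add[OF assms(1)] clinear_scale[OF assms(1)] assms(2))
qed

lemma clinear_id: "clinear id"
  by (simp add: clinear_iff)

lemma clinear_compose: "clinear f \<Longrightarrow> clinear h \<Longrightarrow> clinear (\<lambda>x. f (h x))"
  by (simp add: clinear_iff)

lemma clinear_plus: "clinear f \<Longrightarrow> clinear h \<Longrightarrow> clinear (\<lambda>x. f x + h x)"
  by (simp add: clinear_iff scaleC_add_right algebra_simps)

lemma clinear_tensor_left: "clinear (\<lambda>x. x \<otimes>\<^sub>C y)"
  and clinear_tensor_right: "clinear (\<lambda>y. x \<otimes>\<^sub>C y)"
  using cbilinear_tensor_of unfolding cbilinear_def by blast+

lemma clinear_tensor_map:
  fixes f :: "'a::complex_vector \<Rightarrow> 'c::complex_vector"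
    and h :: "'b::complex_vector \<Rightarrow> 'd::complex_vector"
  assumes "clinear f" "clinear h"
  shows "clinear (tensor_map f h)"
proof -
  have "cbilinear (\<lambda>x y. f x \<otimes>\<^sub>C h y)"
    unfolding cbilinear_def
    using clinear_compose[OF clinear_tensor_left assms(1)] clinear_compose[OF clinear_tensor_right assms(2)]
    by blast
  then show ?thesis unfolding tensor_map_def by (rule clinear_tensor_lift)
qed

text \<open>Pure tensors span. The two-factor version is applied to the outer product with an
  arbitrary inner tensor, and once more to the inner product.\<close>

lemma clinear_tensor_eqI:
  fixes f h :: "(('a::complex_vector, 'b::complex_vector) tensor, 'c::complex_vector) tensor \<Rightarrow> 'd::complex_vector"
  assumes "clinear f" "clinear h" "\<And>x y z. f (x \<otimes>\<^sub>C y \<otimes>\<^sub>C z) = h (x \<otimes>\<^sub>C y \<otimes>\<^sub>C z)"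
  shows "f = h"
proof
  have eqI: "f t = h t"
    if "clinear f" "clinear h" "\<And>x y. f (x \<otimes>\<^sub>C y) = h (x \<otimes>\<^sub>C y)"
    for f h :: "('e::complex_vector, 'g::complex_vector) tensor \<Rightarrow> 'd" and t
  proof -
    have "t \<in> cspan {x \<otimes>\<^sub>C y |x y. True}" unfolding cspan_tensors by (rule UNIV_I)
    then show ?thesis
      by (induction rule: cvs.span_induct_alt)
        (use that in \<open>auto simp: clinear_zero clinear_add clinear_scale\<close>)
  qed
  show "f t = h t" for t
  proof (rule eqI[OF assms(1,2)])
    show "f (s \<otimes>\<^sub>C z) = h (s \<otimes>\<^sub>C z)" for s z
      using eqI[OF clinear_compose[OF assms(1) clinear_tensor_left] clinear_compose[OF assms(2) clinear_tensor_left]]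
        assms(3) by blast
  qed
qed

text \<open>The dual of a quotient is the annihilator of the subspace, tested on generators. This
  turns the coset encoding of coinvariants into equations comparable with those for blocks.\<close>

lemma quotient_dual_span:
  fixes S :: "'a::complex_vector set"
  shows "quotient_dual (cspan S) = {\<phi>. clinear \<phi> \<and> (\<forall>x\<in>S. \<phi> x = 0)}"
proof (intro equalityI subsetI)
  fix \<phi> :: "'a \<Rightarrow> complex" assume "\<phi> \<in> quotient_dual (cspan S)"
  then obtain \<psi> where \<phi>: "\<phi> = (\<lambda>x. \<psi> (coset (cspan S) x))" "clinear \<phi>"
    unfolding quotient_dual_def by blast
  have "\<phi> x = 0" if "x \<in> S" for x
  proof -
    have x: "x \<in> cspan S" using that by (rule cvs.span_base)
    have "coset (cspan S) x = coset (cspan S) 0"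
      unfolding coset_def using cvs.span_add[OF _ x] cvs.span_diff[OF _ x] by force
    then have "\<phi> x = \<phi> 0" by (simp add: \<phi>(1))
    then show ?thesis by (simp add: clinear_zero[OF \<phi>(2)])
  qed
  with \<phi>(2) show "\<phi> \<in> {\<phi>. clinear \<phi> \<and> (\<forall>x\<in>S. \<phi> x = 0)}" by blast
next
  fix \<phi> :: "'a \<Rightarrow> complex" assume "\<phi> \<in> {\<phi>. clinear \<phi> \<and> (\<forall>x\<in>S. \<phi> x = 0)}"
  then have \<phi>: "clinear \<phi>" "\<And>x. x \<in> cspan S \<Longrightarrow> \<phi> x = 0"
    using clinear_zero_on_span[of \<phi> S] by auto
  \<comment> \<open>Two representatives of a coset differ by an element of the span, where \<phi>
    vanishes, so the choice made by \<open>SOME\<close> does not matter.\<close>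
  define \<psi> where "\<psi> C = \<phi> (SOME y. y \<in> C)" for C
  have "\<psi> (coset (cspan S) x) = \<phi> x" for x
  proof -
    have "x \<in> coset (cspan S) x" by (simp add: coset_def cvs.span_zero)
    then have "(SOME y. y \<in> coset (cspan S) x) - x \<in> cspan S"
      by (metis (mono_tags, lifting) coset_def mem_Collect_eq someI)
    then have "\<phi> ((SOME y. y \<in> coset (cspan S) x) - x) = 0" by (rule \<phi>(2))
    then show ?thesis by (simp add: \<psi>_def clinear_diff[OF \<phi>(1)])
  qed
  then show "\<phi> \<in> quotient_dual (cspan S)"
    unfolding quotient_dual_def using \<phi>(1) by (intro CollectI exI[of _ \<psi>]) simp
qed

section \<open>Residues of vertex operators\<close>

lemma weak_module_clinear:
  assumes "weak_module V Y"
  shows "clinear (\<lambda>a. Y a n v)" "clinear (Y a n)"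
  using assms unfolding weak_module_def cbilinear_def by blast+

lemma residue_support:
  assumes "weak_module V Y"
  shows "finite {j::nat. c j *\<^sub>C Y a (int j - n) v \<noteq> 0}"
proof -
  obtain N where N: "\<And>i. i \<ge> N \<Longrightarrow> Y a i v = 0"
    using assms unfolding weak_module_def by meson
  have "{j::nat. c j *\<^sub>C Y a (int j - n) v \<noteq> 0} \<subseteq> {..<nat (N + n)}"
  proof
    fix j assume "j \<in> {j::nat. c j *\<^sub>C Y a (int j - n) v \<noteq> 0}"
    then have "\<not> int j - n \<ge> N" using N by (auto simp: cvs.scale_zero_right)
    then show "j \<in> {..<nat (N + n)}" by auto
  qed
  then show ?thesis by (rule finite_subset) simp
qed

text \<open>The bound \<open>N\<close> depends on \<open>a\<close> and \<open>v\<close> alone, so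
  residues with different exponents and pole orders become finite sums over matching ranges that can
  be compared termwise.\<close>

lemma residue_eq_sum:
  assumes "weak_module V Y"
  shows "\<exists>N. \<forall>p n K. int K \<ge> N + n \<longrightarrow>
    residue Y p n a v = (\<Sum>j<K. (p gchoose j) *\<^sub>C Y a (int j - n) v)"
proof -
  obtain N where N: "\<And>i. i \<ge> N \<Longrightarrow> Y a i v = 0"
    using assms unfolding weak_module_def by meson
  have "residue Y p n a v = (\<Sum>j<K. (p gchoose j) *\<^sub>C Y a (int j - n) v)"
    if K: "int K \<ge> N + n" for p n and K :: nat
    unfolding residue_def
  proof (rule Sum_any.expand_superset)
    show "{j. (p gchoose j) *\<^sub>C Y a (int j - n) v \<noteq> 0} \<subseteq> {..<K}"
    proof
      fix j assume "j \<in> {j. (p gchoose j) *\<^sub>C Y a (int j - n) v \<noteq> 0}"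
      then have "\<not> int j - n \<ge> N" using N by (auto simp: cvs.scale_zero_right)
      with K show "j \<in> {..<K}" by auto
    qed
  qed simp
  then show ?thesis by blast
qed

lemma residue_zero_power:
  assumes "weak_module V Y"
  shows "residue Y 0 n a v = Y a (- n) v"
proof -
  obtain N where N: "\<And>p n K. int K \<ge> N + n \<Longrightarrow>
      residue Y p n a v = (\<Sum>j<K. (p gchoose j) *\<^sub>C Y a (int j - n) v)"
    using residue_eq_sum[OF assms, of a v] by blast
  have "residue Y 0 n a v = (\<Sum>j<Suc (nat (N + n)). (0 gchoose j) *\<^sub>C Y a (int j - n) v)"
    by (rule N) simp
  also have "\<dots> = Y a (- n) v"
    by (subst sum.lessThan_Suc_shift) (simp add: scaleC_one cvs.scale_zero_left)
  finally show ?thesis .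
qed

text \<open>On coefficients, (1 + z)^(p+1) = (1 + z)^p + z (1 + z)^p is Pascal's rule for
  \<open>gchoose\<close>; the factor z lowers the pole order by one.\<close>

lemma residue_pascal:
  assumes "weak_module V Y"
  shows "residue Y (p + 1) n a v = residue Y p n a v + residue Y p (n - 1) a v"
proof -
  obtain N where N: "\<And>p n K. int K \<ge> N + n \<Longrightarrow>
      residue Y p n a v = (\<Sum>j<K. (p gchoose j) *\<^sub>C Y a (int j - n) v)"
    using residue_eq_sum[OF assms, of a v] by blast
  define K where "K = nat (N + n)"
  have "residue Y (p + 1) n a v = (\<Sum>j<Suc K. ((p + 1) gchoose j) *\<^sub>C Y a (int j - n) v)"
    by (rule N) (simp add: K_def)
  also have "\<dots> = Y a (- n) v + (\<Sum>j<K. (p gchoose Suc j) *\<^sub>C Y a (int (Suc j) - n) v)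
      + (\<Sum>j<K. (p gchoose j) *\<^sub>C Y a (int (Suc j) - n) v)"
    by (subst sum.lessThan_Suc_shift)
      (simp add: gbinomial_Suc_Suc scaleC_add_left scaleC_one sum.distrib; simp add: add_ac)
  also have "Y a (- n) v + (\<Sum>j<K. (p gchoose Suc j) *\<^sub>C Y a (int (Suc j) - n) v)
      = (\<Sum>j<Suc K. (p gchoose j) *\<^sub>C Y a (int j - n) v)"
    by (subst sum.lessThan_Suc_shift) (simp add: scaleC_one)
  also have "\<dots> = residue Y p n a v"
    by (rule N[symmetric]) (simp add: K_def)
  also have "(\<Sum>j<K. (p gchoose j) *\<^sub>C Y a (int (Suc j) - n) v)
      = (\<Sum>j<K. (p gchoose j) *\<^sub>C Y a (int j - (n - 1)) v)"
    by (simp add: algebra_simps)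
  also have "\<dots> = residue Y p (n - 1) a v"
    by (rule N[symmetric]) (simp add: K_def)
  finally show ?thesis .
qed

text \<open>Integration by parts: \<open>D\<close> says in modes that Y(a',z)v is the derivative of
  Y(a,z)v, and the two terms on the right come from differentiating z^(-n) and (1 + z)^p.\<close>

lemma residue_deriv:
  assumes "weak_module V Y"
    and D: "\<And>n. Y a' n v = - (of_int n *\<^sub>C Y a (n - 1) v)"
  shows "residue Y p n a' v = of_int n *\<^sub>C residue Y p (n + 1) a v - p *\<^sub>C residue Y (p - 1) n a v"
proof -
  obtain N where N: "\<And>p n K. int K \<ge> N + n \<Longrightarrow>
      residue Y p n a v = (\<Sum>j<K. (p gchoose j) *\<^sub>C Y a (int j - n) v)"
    using residue_eq_sum[OF assms(1), of a v] by blast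
  obtain N' where N': "\<And>p n K. int K \<ge> N' + n \<Longrightarrow>
      residue Y p n a' v = (\<Sum>j<K. (p gchoose j) *\<^sub>C Y a' (int j - n) v)"
    using residue_eq_sum[OF assms(1), of a' v] by blast
  define K where "K = nat (max N N' + n)"
  have K: "int K \<ge> N + n" "int K \<ge> N' + n" by (auto simp: K_def)
  have "residue Y p n a' v = (\<Sum>j<Suc K. (p gchoose j) *\<^sub>C Y a' (int j - n) v)"
    by (rule N') (use K in simp)
  also have "\<dots> = (\<Sum>j<Suc K. of_int n *\<^sub>C (p gchoose j) *\<^sub>C Y a (int j - (n + 1)) v
      - (of_nat j * (p gchoose j)) *\<^sub>C Y a (int j - (n + 1)) v)"
    by (rule sum.cong)
      (simp_all add: D scaleC_scaleC diff_diff_eq cvs.scale_left_diff_distrib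
        cvs.scale_right_diff_distrib mult.commute)
  also have "\<dots> = of_int n *\<^sub>C (\<Sum>j<Suc K. (p gchoose j) *\<^sub>C Y a (int j - (n + 1)) v)
      - (\<Sum>j<Suc K. (of_nat j * (p gchoose j)) *\<^sub>C Y a (int j - (n + 1)) v)"
    by (simp only: sum_subtractf cvs.scale_sum_right)
  also have "(\<Sum>j<Suc K. (p gchoose j) *\<^sub>C Y a (int j - (n + 1)) v) = residue Y p (n + 1) a v"
    by (rule N[symmetric]) (use K in simp)
  also have "(\<Sum>j<Suc K. (of_nat j * (p gchoose j)) *\<^sub>C Y a (int j - (n + 1)) v)
      = p *\<^sub>C (\<Sum>j<K. ((p - 1) gchoose j) *\<^sub>C Y a (int j - n) v)"
  proof -
    \<comment> \<open>The absorption identity for binomial coefficients. The term with j = 0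
      vanishes, so the index shift leaves \<open>K\<close> of the \<open>Suc K\<close>
      terms.\<close>
    have "of_nat (Suc j) * (p gchoose Suc j) = p * ((p - 1) gchoose j)" for j
      using Suc_times_gbinomial[of j "p - 1"] by simp
    moreover have index: "int (Suc j) - (n + 1) = int j - n" for j by simp
    ultimately show ?thesis
      by (subst sum.lessThan_Suc_shift)
        (simp add: index cvs.scale_zero_left cvs.scale_sum_right scaleC_scaleC del: of_nat_Suc)
  qed
  also have "(\<Sum>j<K. ((p - 1) gchoose j) *\<^sub>C Y a (int j - n) v) = residue Y (p - 1) n a v"
    by (rule N[symmetric]) (use K in simp)
  finally show ?thesis .
qed

lemma clinear_residue:
  fixes Y :: "'v::complex_vector \<Rightarrow> int \<Rightarrow> 'm::complex_vector \<Rightarrow> 'm"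
  assumes "weak_module V Y"
  shows "clinear (residue Y p n a)"
  unfolding clinear_iff
proof (intro conjI allI)
  fix v w :: 'm and c :: complex
  note lin = weak_module_clinear(2)[OF assms]
  show "residue Y p n a (v + w) = residue Y p n a v + residue Y p n a w"
    unfolding residue_def clinear_add[OF lin] scaleC_add_right
    by (rule Sum_any.distrib) (rule residue_support[OF assms])+
  have "residue Y p n a (c *\<^sub>C v) = Sum_any (\<lambda>j::nat. c *\<^sub>C (p gchoose j) *\<^sub>C Y a (int j - n) v)"
    unfolding residue_def by (simp add: clinear_scale[OF lin] scaleC_scaleC mult.commute)
  also have "\<dots> = c *\<^sub>C residue Y p n a v"
    unfolding residue_def
    by (rule clinear_Sum_any[OF _ residue_support[OF assms], symmetric])
      (simp add: clinear_iff scaleC_add_right scaleC_scaleC mult.commute)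
  finally show "residue Y p n a (c *\<^sub>C v) = c *\<^sub>C residue Y p n a v" .
qed

text \<open>With the fixed tensor factors moved out of the sum, the generators of
  \<open>J_space\<close> can be written with a single residue in the middle slot.\<close>

lemma tensor_residue:
  assumes "weak_module V Y"
  shows "Sum_any (\<lambda>j::nat. (p gchoose j) *\<^sub>C (x \<otimes>\<^sub>C Y a (int j - n) v \<otimes>\<^sub>C y))
    = x \<otimes>\<^sub>C residue Y p n a v \<otimes>\<^sub>C y"
proof -
  have lin: "clinear (\<lambda>v. x \<otimes>\<^sub>C v \<otimes>\<^sub>C y)"
    by (rule clinear_compose[OF clinear_tensor_left clinear_tensor_right])
  show ?thesis
    unfolding residue_def
    by (subst clinear_Sum_any[OF lin residue_support[OF assms]]) (simp add: clinear_scale[OF lin])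
qed

section \<open>The translation operator\<close>

text \<open>The axiom on the modes of L(-1) a is read at mode -1 on the vacuum, where creation
  returns the vector itself.\<close>

lemma translation_vac:
  assumes "vertex_operator_algebra V"
  shows "Lop V (mode V) (-1) a = mode V a (-2) (vac V)"
proof -
  have "mode V (Lop V (mode V) (-1) a) (-1) (vac V) = - (of_int (-1) *\<^sub>C mode V a (-1 - 1) (vac V))"
    using assms unfolding vertex_operator_algebra_def by blast
  moreover have "mode V (Lop V (mode V) (-1) a) (-1) (vac V) = Lop V (mode V) (-1) a"
    using assms unfolding vertex_operator_algebra_def by blast
  ultimately show ?thesis by (simp add: cvs.scale_minus_left scaleC_one)
qed

text \<open>The case \<open>b = 1\<close>, \<open>m = 0\<close>, \<open>n = -2\<close> of the Jacobi identity; only the summand with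
  \<open>j = \<bar>i\<bar> - 1\<close> survives on its right-hand side.\<close>

lemma weak_module_translation:
  fixes Y :: "'v::complex_vector \<Rightarrow> int \<Rightarrow> 'm::complex_vector \<Rightarrow> 'm"
  assumes V: "vertex_operator_algebra V" and Y: "weak_module V Y"
  shows "Y (Lop V (mode V) (-1) a) i v = - (of_int i *\<^sub>C Y a (i - 1) v)"
proof -
  note lin = weak_module_clinear[OF Y]
  have vac: "Y (vac V) n w = (if n = -1 then w else 0)" for n w
    using Y unfolding weak_module_def by blast
  \<comment> \<open>These are the coefficients j + 1 of (1 - z)^(-2).\<close>
  have c: "(-1) ^ j * ((of_int (-2) :: complex) gchoose j) = of_nat (Suc j)" for j :: nat
  proof -
    have "((of_int (-2) :: complex) gchoose j) = (-1) ^ j * (of_nat (Suc j) gchoose j)"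
      using gbinomial_minus[of 2 j] by (simp add: add_ac)
    also have "(of_nat (Suc j) :: complex) gchoose j = of_nat (Suc j)"
      by (simp only: binomial_gbinomial[symmetric]) simp
    finally show ?thesis by (simp add: mult.assoc[symmetric] power_mult_distrib[symmetric])
  qed
  have "Y (mode V a (-2) (vac V)) i v
      = Sum_any (\<lambda>j::nat. ((of_int 0 :: complex) gchoose j) *\<^sub>C
            Y (mode V a (-2 + int j) (vac V)) (0 + i - int j) v)"
  proof -
    have "((of_int 0 :: complex) gchoose j) *\<^sub>C Y (mode V a (-2 + int j) (vac V)) (0 + i - int j) v
      = (if j = 0 then Y (mode V a (-2) (vac V)) i v else 0)" for j :: nat
      by (cases j) (simp_all add: scaleC_one cvs.scale_zero_left)
    then show ?thesis by simp
  qed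
  also have "\<dots> = Sum_any (\<lambda>j::nat. ((-1) ^ j * ((of_int (-2) :: complex) gchoose j)) *\<^sub>C
            (Y a (0 + -2 - int j) (Y (vac V) (i + int j) v)
             - ((-1) powi -2) *\<^sub>C Y (vac V) (-2 + i - int j) (Y a (0 + int j) v)))"
    using Y unfolding weak_module_def by blast
  also have "\<dots> = Sum_any (\<lambda>j::nat. if j = nat (\<bar>i\<bar> - 1) then - (of_int i *\<^sub>C Y a (i - 1) v) else 0)"
  proof (rule Sum_any.cong)
    fix j :: nat
    have "of_nat (Suc j) *\<^sub>C (Y a (-2 - int j) (Y (vac V) (i + int j) v)
             - Y (vac V) (-2 + i - int j) (Y a (int j) v))
      = (if j = nat (\<bar>i\<bar> - 1) then - (of_int i *\<^sub>C Y a (i - 1) v) else 0)"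
    proof -
      \<comment> \<open>A vacuum mode survives only at index -1: the inner one if i + j = -1, the
        outer one if i - j = 1. For i = 0 neither occurs; \<open>nat (\<bar>i\<bar> - 1)\<close> is
        then 0, but the value it selects carries the factor i = 0.\<close>
      consider "i = 0" | "i + int j = -1" | "i - int j = 1" | "i \<noteq> 0" "i + int j \<noteq> -1" "i - int j \<noteq> 1"
        by linarith
      then show ?thesis
      proof cases
        case 1
        then show ?thesis by (simp add: vac clinear_zero[OF lin(2)] cvs.scale_zero_left cvs.scale_zero_right)
      next
        case 2
        then have i: "i = - 1 - int j" by simp
        have "complex_of_int i = - of_nat (Suc j)" by (simp add: i)
        then have "- (of_int i *\<^sub>C w) = of_nat (Suc j) *\<^sub>C w" for w :: 'm
          by (simp add: cvs.scale_minus_left del: of_nat_Suc)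
        then show ?thesis by (simp add: vac i del: of_nat_Suc)
      next
        case 3
        then have i: "i = 1 + int j" by simp
        have "complex_of_int i = of_nat (Suc j)" by (simp add: i)
        then show ?thesis
          using 3 by (simp add: vac i cvs.scale_minus_right clinear_zero[OF lin(2)])
      next
        case 4
        then have "j \<noteq> nat (\<bar>i\<bar> - 1)" by auto
        with 4 show ?thesis by (simp add: vac clinear_zero[OF lin(2)] cvs.scale_zero_right)
      qed
    qed
    then show "((-1) ^ j * ((of_int (-2) :: complex) gchoose j)) *\<^sub>C
            (Y a (0 + -2 - int j) (Y (vac V) (i + int j) v)
             - ((-1) powi -2) *\<^sub>C Y (vac V) (-2 + i - int j) (Y a (0 + int j) v))
        = (if j = nat (\<bar>i\<bar> - 1) then - (of_int i *\<^sub>C Y a (i - 1) v) else 0)"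
      by (simp only: c) (simp add: power_int_minus scaleC_one)
  qed
  also have "\<dots> = - (of_int i *\<^sub>C Y a (i - 1) v)" by simp
  finally show ?thesis by (simp only: translation_vac[OF V])
qed

text \<open>Converse of the axiom on L(0): eigenvectors for distinct weights are independent, so an
  eigenvector for n has no component of another weight.\<close>

lemma wt_space_eigenvalue:
  assumes V: "vertex_operator_algebra V" and "Lop V (mode V) 0 x = of_nat n *\<^sub>C x"
  shows "x \<in> wt_space V n"
proof -
  let ?W = "wt_space V" and ?L = "Lop V (mode V) 0"
  have sub: "csubspace (?W k)" for k
    using V unfolding vertex_operator_algebra_def direct_sum_def by blast
  have ex1: "\<exists>!f. (\<forall>k. f k \<in> ?W k) \<and> finite {k. f k \<noteq> 0} \<and> x = Sum_any f" for x
    using V unfolding vertex_operator_algebra_def direct_sum_def by blast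
  have L: "?L a = of_nat k *\<^sub>C a" if "a \<in> ?W k" for a k
    using V that unfolding vertex_operator_algebra_def by blast
  have "weak_module V (mode V)"
    using V unfolding vertex_operator_algebra_def by blast
  then have lin: "clinear ?L" unfolding Lop_def by (rule weak_module_clinear(2))
  obtain f where f: "\<And>k. f k \<in> ?W k" "finite {k. f k \<noteq> 0}" "x = Sum_any f"
    using ex1[of x] by blast
  \<comment> \<open>\<open>d k\<close> is the component of weight k of L(0) x - n x, which is
    zero.\<close>
  define d where "d k = (of_nat k - of_nat n :: complex) *\<^sub>C f k" for k
  have fin: "finite {k. (c k :: complex) *\<^sub>C f k \<noteq> 0}" for c
    by (rule finite_subset[OF _ f(2)]) (auto simp: cvs.scale_zero_right)
  have "?L x = Sum_any (\<lambda>k. of_nat k *\<^sub>C f k)"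
    unfolding f(3) by (subst clinear_Sum_any[OF lin f(2)]) (simp add: L[OF f(1)])
  moreover have "of_nat n *\<^sub>C x = Sum_any (\<lambda>k. of_nat n *\<^sub>C f k)"
    unfolding f(3) by (rule clinear_Sum_any)
      (simp_all add: clinear_iff f(2) scaleC_add_right scaleC_scaleC mult.commute)
  moreover have "Sum_any (\<lambda>k. of_nat k *\<^sub>C f k) = Sum_any d + Sum_any (\<lambda>k. of_nat n *\<^sub>C f k)"
    unfolding d_def
    by (subst Sum_any.distrib[OF fin fin, symmetric]) (simp add: cvs.scale_left_diff_distrib)
  ultimately have "Sum_any d = 0" using assms(2) by simp
  moreover have "d k \<in> ?W k" for k
    unfolding d_def by (rule cvs.subspace_scale[OF sub f(1)])
  moreover have "finite {k. d k \<noteq> 0}" unfolding d_def by (rule fin)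
  moreover have "0 \<in> ?W k" for k by (rule cvs.subspace_0[OF sub])
  \<comment> \<open>Uniqueness of the decomposition of 0, used to compare \<open>d\<close> with the
    zero family.\<close>
  moreover have "f1 = f2" if "\<forall>k. f1 k \<in> ?W k" "finite {k. f1 k \<noteq> 0}" "0 = Sum_any f1"
    "\<forall>k. f2 k \<in> ?W k" "finite {k. f2 k \<noteq> 0}" "0 = Sum_any f2" for f1 f2
    using ex1[of 0] that by blast
  from this[of d "\<lambda>k. 0"] calculation have "d = (\<lambda>k. 0)" by simp
  then have d0: "(of_nat k - of_nat n :: complex) *\<^sub>C f k = 0" for k
    unfolding d_def by (rule fun_cong)
  have "f k = 0" if "k \<noteq> n" for k
    using that d0[of k] by (simp add: cvs.scale_eq_0_iff)
  then have "f = (\<lambda>k. if k = n then f n else 0)" by auto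
  then have "Sum_any f = Sum_any (\<lambda>k. if k = n then f n else 0)" by (rule arg_cong)
  then have "Sum_any f = f n" by simp
  then show ?thesis using f(1)[of n] f(3) by simp
qed

text \<open>The Virasoro relation [L(0), L(-1)] = L(-1), which has no central term, raises the
  eigenvalue by one, and the eigenvalue determines the weight space.\<close>

lemma wt_space_translation:
  assumes V: "vertex_operator_algebra V" and a: "a \<in> wt_space V k"
  shows "Lop V (mode V) (-1) a \<in> wt_space V (Suc k)"
proof (rule wt_space_eigenvalue[OF V])
  let ?L = "Lop V (mode V)"
  have "weak_module V (mode V)"
    using V unfolding vertex_operator_algebra_def by blast
  then have lin: "clinear (?L n)" for n unfolding Lop_def by (rule weak_module_clinear(2))
  obtain c :: complex where vir: "\<And>m n v. ?L m (?L n v) - ?L n (?L m v)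
      = of_int (m - n) *\<^sub>C ?L (m + n) v
        + (if m + n = 0 then (of_int (m ^ 3 - m) / 12 * c) *\<^sub>C v else 0)"
    using V unfolding vertex_operator_algebra_def by blast
  have L0: "?L 0 a = of_nat k *\<^sub>C a"
    using V a unfolding vertex_operator_algebra_def by blast
  have "?L 0 (?L (-1) a) = ?L (-1) (?L 0 a) + ?L (-1) a"
    using vir[of 0 "-1" a] by (simp add: scaleC_one algebra_simps)
  also have "\<dots> = of_nat (Suc k) *\<^sub>C ?L (-1) a"
    by (simp add: L0 clinear_scale[OF lin] scaleC_add_left scaleC_one add.commute)
  finally show "?L 0 (?L (-1) a) = of_nat (Suc k) *\<^sub>C ?L (-1) a" .
qed

text \<open>An automorphism fixes the conformal vector and hence commutes with L(-1).\<close>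

lemma eigenspace_translation:
  assumes V: "vertex_operator_algebra V" and "voa_automorphism V g" "a \<in> eigenspace g T r"
  shows "Lop V (mode V) (-1) a \<in> eigenspace g T r"
proof -
  have "weak_module V (mode V)"
    using V unfolding vertex_operator_algebra_def by blast
  from clinear_scale[OF weak_module_clinear(2)[OF this]] show ?thesis
    using assms(2,3) unfolding voa_automorphism_def eigenspace_def Lop_def by simp
qed

text \<open>This is the generator of \<open>zhu_O\<close> with r = 0 and b the vacuum: the exponent
  is k, the pole order is 2, and creation kills all modes except -2 and -1.\<close>

lemma zhu_O_translation:
  assumes V: "vertex_operator_algebra V" and "T \<ge> 1"
    and a: "a \<in> wt_space V k" "a \<in> eigenspace g T 0"
  shows "Lop V (mode V) (-1) a + of_nat k *\<^sub>C a \<in> zhu_O V g T"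
proof -
  have creation: "mode V a (-1) (vac V) = a" "\<And>n. n \<ge> 0 \<Longrightarrow> mode V a n (vac V) = 0"
    using V unfolding vertex_operator_algebra_def by blast+
  have "residue (mode V) (of_nat k) 2 a (vac V)
      = (\<Sum>j<2. ((of_nat k :: complex) gchoose j) *\<^sub>C mode V a (int j - 2) (vac V))"
    unfolding residue_def
  proof (rule Sum_any.expand_superset)
    have "mode V a (int j - 2) (vac V) = 0" if "j \<ge> 2" for j
      using that by (intro creation(2)) simp
    then show "{j. ((of_nat k :: complex) gchoose j) *\<^sub>C mode V a (int j - 2) (vac V) \<noteq> 0} \<subseteq> {..<2}"
      by (auto simp: not_less[symmetric] cvs.scale_zero_right)
  qed simp
  also have "\<dots> = Lop V (mode V) (-1) a + of_nat k *\<^sub>C a"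
    by (simp add: numeral_2_eq_2 translation_vac[OF V] creation scaleC_one)
  finally show ?thesis
    unfolding zhu_O_def
    by (intro cvs.span_base CollectI exI[of _ k] exI[of _ "0::nat"] exI[of _ a] exI[of _ "vac V"])
      (use assms in simp)
qed

text \<open>\<open>f\<close> evaluates classes on a fixed vector. Its linearity is stated on
  representatives, because cosets are plain sets without a vector space structure.\<close>

lemma zhu_class_translation:
  assumes "vertex_operator_algebra V" "T \<ge> 1" "a \<in> wt_space V k" "a \<in> eigenspace g T 0"
    and lin: "clinear (\<lambda>a. f (zhu_class V g T a))"
  shows "f (zhu_class V g T (Lop V (mode V) (-1) a)) = - (of_nat k *\<^sub>C f (zhu_class V g T a))"
proof -
  let ?x = "Lop V (mode V) (-1) a + of_nat k *\<^sub>C a"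
  have x: "?x \<in> zhu_O V g T" by (rule zhu_O_translation) (use assms in auto)
  have "zhu_class V g T ?x = zhu_class V g T 0"
    unfolding coset_def
    using cvs.span_add[OF _ x[unfolded zhu_O_def]] cvs.span_diff[OF _ x[unfolded zhu_O_def]]
    unfolding zhu_O_def[symmetric] by force
  then have "f (zhu_class V g T ?x) = 0" using clinear_zero[OF lin] by simp
  then show ?thesis
    using clinear_add[OF lin] clinear_scale[OF lin] by (simp add: eq_neg_iff_add_eq_0)
qed

section \<open>The relations between residues\<close>

text \<open>Induction on the pole order, for all \<open>a\<close> and \<open>k\<close> at once,
  since the hypothesis is needed for L(-1) a of weight k + 1. In the application \<beta> is the
  action at zero.\<close>

lemma lowest_residue_relation:
  fixes \<psi> :: "'m::complex_vector \<Rightarrow> complex" and V :: "('v::complex_vector, 'x) voa_scheme"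
  assumes V: "vertex_operator_algebra V" and g: "voa_automorphism V g"
    and Y: "weak_module V Y" and lin: "clinear \<psi>"
    and simple_pole: "\<And>k a. a \<in> wt_space V k \<Longrightarrow> a \<in> eigenspace g T r \<Longrightarrow>
      \<psi> (residue Y (of_nat k - 1 + of_nat r / of_nat T) 1 a v) = (if r = 0 then \<beta> a else 0)"
    and \<beta>: "\<And>k a. r = 0 \<Longrightarrow> a \<in> wt_space V k \<Longrightarrow> a \<in> eigenspace g T 0 \<Longrightarrow>
      \<beta> (Lop V (mode V) (-1) a) = - (of_nat k * \<beta> a)"
    and "a \<in> wt_space V k" "a \<in> eigenspace g T r"
  shows "\<psi> (residue Y (of_nat k - 1 + of_nat r / of_nat T) (int (Suc n)) a v)
    = (if r = 0 then (-1) ^ n * \<beta> a else 0)"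
  using assms(7,8)
proof (induction n arbitrary: a k)
  case 0
  then show ?case using simple_pole by simp
next
  case (Suc n)
  let ?p = "of_nat k - 1 + of_nat r / of_nat T :: complex" and ?n = "int (Suc n)"
    and ?a' = "Lop V (mode V) (-1) a"
  let ?X = "\<lambda>n. \<psi> (residue Y ?p n a v)"
  \<comment> \<open>The lowest exponent for L(-1) a is \<open>?p + 1\<close>, as its weight is one
    higher.\<close>
  have "\<psi> (residue Y (of_nat (Suc k) - 1 + of_nat r / of_nat T) ?n ?a' v)
      = (if r = 0 then (-1) ^ n * \<beta> ?a' else 0)"
    by (rule Suc.IH[OF wt_space_translation[OF V Suc.prems(1)] eigenspace_translation[OF V g Suc.prems(2)]])
  moreover have "of_nat (Suc k) - 1 + of_nat r / of_nat T = ?p + 1" by simp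
  moreover have deriv: "residue Y (?p + 1) ?n ?a' v
      = of_int ?n *\<^sub>C residue Y (?p + 1) (?n + 1) a v - (?p + 1) *\<^sub>C residue Y ?p ?n a v"
    using residue_deriv[OF Y, OF weak_module_translation[OF V Y], of "?p + 1" ?n a v]
    by (simp only: add_diff_cancel_right')
  \<comment> \<open>This brings the term of the higher pole order back to exponent
    \<open>?p\<close>, so that only the values \<open>?X\<close> at poles \<open>?n\<close> and
    \<open>?n + 1\<close> remain.\<close>
  have pascal: "residue Y (?p + 1) (?n + 1) a v = residue Y ?p (?n + 1) a v + residue Y ?p ?n a v"
    using residue_pascal[OF Y, of ?p "?n + 1"] by (simp only: add_diff_cancel_right')
  have "\<psi> (residue Y (?p + 1) ?n ?a' v) = of_int ?n * (?X (?n + 1) + ?X ?n) - (?p + 1) * ?X ?n"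
    by (simp only: deriv pascal clinear_diff[OF lin] clinear_add[OF lin] clinear_scale[OF lin]
      scaleC_complex_def)
  ultimately have "of_int ?n * (?X (?n + 1) + ?X ?n) - (?p + 1) * ?X ?n
      = (if r = 0 then (-1) ^ n * \<beta> ?a' else 0)"
    by (simp only:)
  moreover have "c * x = z + q * y - c * y" if "c * (x + y) - q * y = z" for c q x y z :: complex
    using that by (simp add: algebra_simps)
  ultimately have by_parts: "of_int ?n * ?X (?n + 1)
      = (if r = 0 then (-1) ^ n * \<beta> ?a' else 0) + (?p + 1) * ?X ?n - of_int ?n * ?X ?n"
    by blast
  \<comment> \<open>For r = 0 one has \<open>?p + 1\<close> = k, so the term with \<beta> of L(-1) a
    cancels k \<open>?X ?n\<close>; what is left is \<open>?X ?n\<close> times minus the pole order,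
    whence the alternating sign.\<close>
  have "of_int ?n * ?X (?n + 1) = of_int ?n * (if r = 0 then (-1) ^ Suc n * \<beta> a else 0)"
  proof (cases "r = 0")
    case True
    then show ?thesis
      unfolding by_parts Suc.IH[OF Suc.prems]
      using \<beta>[OF True Suc.prems(1)] Suc.prems(2) by (simp add: algebra_simps)
  next
    case False
    then show ?thesis unfolding by_parts Suc.IH[OF Suc.prems] by simp
  qed
  \<comment> \<open>Division by the pole order is possible because the induction starts at a simple
    pole.\<close>
  moreover have "?n + 1 = int (Suc (Suc n))" "(of_int ?n :: complex) \<noteq> 0"
    by (simp_all del: of_nat_Suc)
  ultimately show ?case by (simp only: mult_cancel_left) simp
qed

text \<open>Induction on the excess i of the exponent over its lowest value. In the application
  \<alpha> is the action at infinity and \<beta> the action at zero.\<close>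

lemma residue_relation:
  fixes \<psi> :: "'m::complex_vector \<Rightarrow> complex" and V :: "('v::complex_vector, 'x) voa_scheme"
  assumes V: "vertex_operator_algebra V" and g: "voa_automorphism V g"
    and Y: "weak_module V Y" and lin: "clinear \<psi>"
    and simple_pole: "\<And>k a. a \<in> wt_space V k \<Longrightarrow> a \<in> eigenspace g T r \<Longrightarrow>
      \<psi> (residue Y (of_nat k - 1 + of_nat r / of_nat T) 1 a v) = (if r = 0 then \<beta> a else 0)"
    and \<alpha>: "\<And>k a. r = 0 \<Longrightarrow> a \<in> wt_space V k \<Longrightarrow> a \<in> eigenspace g T 0 \<Longrightarrow>
      \<psi> (residue Y (of_nat k) 1 a v) = \<alpha> a"
    and \<beta>: "\<And>k a. r = 0 \<Longrightarrow> a \<in> wt_space V k \<Longrightarrow> a \<in> eigenspace g T 0 \<Longrightarrow>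
      \<beta> (Lop V (mode V) (-1) a) = - (of_nat k * \<beta> a)"
    and a: "a \<in> wt_space V k" "a \<in> eigenspace g T r"
    and "i + (if r = 0 then 0 else 1) \<le> n"
  shows "\<psi> (residue Y (of_nat k - 1 + of_nat r / of_nat T + of_nat i) (int n) a v)
    = (if r = 0 \<and> i = n then \<alpha> a else 0) - (if r = 0 \<and> i = 0 then (-1) ^ n * \<beta> a else 0)"
  using assms(10)
proof (induction i arbitrary: n)
  case 0
  show ?case
  proof (cases n)
    case (Suc n')
    then show ?thesis
      using lowest_residue_relation[OF V g Y lin simple_pole \<beta> a, of n'] by simp
  next
    \<comment> \<open>Pole order 0 is not reached by raising a simple pole. For r = 0, Pascal's rule
      gives it as the difference of the simple pole relations at exponents k and k - 1, that is,
      \<alpha> - \<beta>.\<close>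
    case n: 0
    with 0 have r: "r = 0" by (auto split: if_splits)
    have "residue Y (of_nat k - 1 + 1) 1 a v = residue Y (of_nat k - 1) 1 a v + residue Y (of_nat k - 1) 0 a v"
      using residue_pascal[OF Y, of "of_nat k - 1" 1] by simp
    then show ?thesis
      using \<alpha>[OF r a(1)] simple_pole[OF a] a(2) r n by (simp add: clinear_add[OF lin] algebra_simps)
  qed
next
  case (Suc i)
  let ?p = "of_nat k - 1 + of_nat r / of_nat T :: complex"
  obtain n' where n: "n = Suc n'" using Suc.prems by (cases n) auto
  have "residue Y (?p + of_nat (Suc i)) (int n) a v
      = residue Y (?p + of_nat i) (int n) a v + residue Y (?p + of_nat i) (int n') a v"
    using residue_pascal[OF Y, of "?p + of_nat i" "int n"] by (simp add: n add_ac)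
  then have "\<psi> (residue Y (?p + of_nat (Suc i)) (int n) a v)
      = \<psi> (residue Y (?p + of_nat i) (int n) a v) + \<psi> (residue Y (?p + of_nat i) (int n') a v)"
    by (simp only: clinear_add[OF lin])
  moreover have "i + (if r = 0 then 0 else 1) \<le> n" "i + (if r = 0 then 0 else 1) \<le> n'"
    using Suc.prems n by auto
  note Suc.IH[OF this(1)] Suc.IH[OF this(2)]
  \<comment> \<open>The \<alpha> term comes only from pole order n - 1, when i = n - 1. For i = 0
    the two \<beta> terms have opposite signs and cancel.\<close>
  ultimately show ?case
    using Suc.prems by (simp only:) (auto simp: n)
qed

section \<open>Conformal blocks and coinvariants\<close>

text \<open>Ensures that a form lies in its own residue class, so that the operator of each
  generating form contributes to \<open>action_image\<close>.\<close>

lemma nabla_image_zero: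
  assumes "vertex_operator_algebra V" "voa_automorphism V g"
  shows "0 \<in> nabla_image V g T"
proof -
  have lin: "clinear g" "weak_module V (mode V)"
    using assms unfolding voa_automorphism_def vertex_operator_algebra_def by blast+
  have deriv: "clinear (deriv_z T)"
  proof -
    \<comment> \<open>Written as multiplication by a constant series, the scalar action visibly
      commutes with \<open>fls_deriv\<close> and with division.\<close>
    have scale: "c *\<^sub>C f = fls_const c * f" for c and f :: "complex fls"
      by (rule fls_eqI) (simp add: scaleC_fls.rep_eq)
    show ?thesis
      unfolding clinear_iff deriv_z_def scale by (simp add: add_divide_distrib)
  qed
  have "0 \<in> invariant_forms g T"
    unfolding invariant_forms_def
    using clinear_zero[OF clinear_tensor_map[OF lin(1) clinear_deck_rotation]] by (simp add: cvs.span_zero)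
  moreover have "clinear (Lop V (mode V) (-1))"
    unfolding Lop_def by (rule weak_module_clinear(2)[OF lin(2)])
  ultimately show ?thesis
    unfolding nabla_image_def
    by (intro image_eqI[of _ _ 0])
      (simp_all add: clinear_zero[OF clinear_tensor_map[OF _ clinear_id]]
        clinear_zero[OF clinear_tensor_map[OF clinear_id deriv]])
qed

text \<open>Closing \<open>acts_as\<close> under linear combinations imposes no further condition on
  a linear functional, so vanishing need only be tested on generating forms.\<close>

lemma restricted_conformal_blocks_iff:
  assumes "vertex_operator_algebra V" "voa_automorphism V g"
  shows "\<phi> \<in> restricted_conformal_blocks V g T M ract lact \<longleftrightarrow> clinear \<phi> \<and>
    (\<forall>a k r m n t. constrained V g T a k r m n \<longrightarrow> \<phi> (form_action V g T M ract lact a k r m n t) = 0)"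
    (is "_ \<longleftrightarrow> clinear \<phi> \<and> ?R")
proof
  assume L: "\<phi> \<in> restricted_conformal_blocks V g T M ract lact"
  have "form_action V g T M ract lact a k r m n t \<in> action_image V g T M ract lact"
    if c: "constrained V g T a k r m n" for a k r m n t
  proof -
    let ?f = "form T a r m n"
    have "coset (nabla_image V g T) ?f \<in> constrained_space V g T"
      unfolding constrained_space_def by (intro imageI cvs.span_base) (use c in blast)
    moreover have "?f \<in> coset (nabla_image V g T) ?f"
      using nabla_image_zero[OF assms] by (simp add: coset_def)
    ultimately show ?thesis
      unfolding action_image_def using acts_as.generator[OF c] by (intro cvs.span_base) blast
  qed
  with L show "clinear \<phi> \<and> ?R" unfolding restricted_conformal_blocks_def by blast
next
  assume R: "clinear \<phi> \<and> ?R"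
  then have lin: "clinear \<phi>" by blast
  have "\<phi> (F t) = 0" if "acts_as V g T M ract lact x F" for x F t
    using that
  proof (induction arbitrary: t)
    case generator
    then show ?case using R by blast
  qed (simp_all add: clinear_zero[OF lin] clinear_add[OF lin] clinear_scale[OF lin])
  then have "\<phi> t = 0" if "t \<in> action_image V g T M ract lact" for t
    using clinear_zero_on_span[OF lin _ that[unfolded action_image_def]] by blast
  then show "\<phi> \<in> restricted_conformal_blocks V g T M ract lact"
    unfolding restricted_conformal_blocks_def using lin by blast
qed

text \<open>The values of \<open>tensor_map\<close> on pure tensors are known for linear maps, so
  linearity of the three local operators is established first.\<close>

lemma form_action_tensor:
  assumes M: "weak_module V (act_mode M)"
    and lact: "left_zhu_module V g T lact" and ract: "right_zhu_module V g T ract"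
  shows "clinear (form_action V g T M ract lact a k r m n)"
    and "form_action V g T M ract lact a k r m n (u3 \<otimes>\<^sub>C v \<otimes>\<^sub>C u2)
      = u3 \<otimes>\<^sub>C residue (act_mode M) (complex_of_real (real r / real T + of_int m)) (int n) a v \<otimes>\<^sub>C u2
        - (if real r / real T + of_int m - real n = real k - 1
           then ract u3 (zhu_class V g T a) \<otimes>\<^sub>C v \<otimes>\<^sub>C u2 else 0)
        + (if real r / real T + of_int m = real k - 1
           then (-1) ^ n *\<^sub>C (u3 \<otimes>\<^sub>C v \<otimes>\<^sub>C lact (zhu_class V g T a) u2) else 0)"
proof -
  let ?s = "real r / real T + of_int m"
  define A where "A = (\<lambda>u3. if ?s - real n = real k - 1 then - ract u3 (zhu_class V g T a) else 0)"
  define B where "B = (\<lambda>u2. if ?s = real k - 1 then (-1) ^ n *\<^sub>C lact (zhu_class V g T a) u2 else 0)"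
  define R where "R = residue (act_mode M) (complex_of_real ?s) (int n) a"
  have eq: "form_action V g T M ract lact a k r m n = (\<lambda>t.
      tensor_map (tensor_map A id) id t + tensor_map (tensor_map id R) id t
      + tensor_map (tensor_map id id) B t)"
    unfolding form_action_def Let_def A_def B_def R_def ..
  have "clinear (\<lambda>u. ract u (zhu_class V g T a))" "clinear (lact (zhu_class V g T a))"
    using lact ract unfolding left_zhu_module_def right_zhu_module_def cbilinear_def by blast+
  then have lin: "clinear A" "clinear B" "clinear R"
    unfolding A_def B_def R_def
    by (simp_all add: clinear_residue[OF M])
      (simp_all add: clinear_iff scaleC_add_right scaleC_scaleC mult.commute
        cvs.scale_minus_right cvs.scale_zero_right)
  note clinear_id[simp] lin[simp] clinear_tensor_map[simp] tensor_map_tensor_of[simp]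
  show "clinear (form_action V g T M ract lact a k r m n)"
    unfolding eq by (intro clinear_plus) simp_all
  show "form_action V g T M ract lact a k r m n (u3 \<otimes>\<^sub>C v \<otimes>\<^sub>C u2)
      = u3 \<otimes>\<^sub>C residue (act_mode M) (complex_of_real ?s) (int n) a v \<otimes>\<^sub>C u2
        - (if ?s - real n = real k - 1 then ract u3 (zhu_class V g T a) \<otimes>\<^sub>C v \<otimes>\<^sub>C u2 else 0)
        + (if ?s = real k - 1 then (-1) ^ n *\<^sub>C (u3 \<otimes>\<^sub>C v \<otimes>\<^sub>C lact (zhu_class V g T a) u2) else 0)"
    unfolding eq R_def[symmetric]
    by simp
      (simp add: A_def B_def clinear_zero[OF clinear_tensor_left] clinear_neg[OF clinear_tensor_left]
        clinear_zero[OF clinear_tensor_right] clinear_scale[OF clinear_tensor_right])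
qed

text \<open>Here i is the excess of the exponent of z over its lowest value wt a - 1 + r/T. As 0
  \<le> r/T < 1, the real inequalities become integer ones, and for r \<noteq> 0 the fractional part
  costs one more order of pole.\<close>

lemma constrained_iff:
  assumes "T \<ge> 1"
  shows "constrained V g T a k r m n \<longleftrightarrow> r < T \<and> a \<in> wt_space V k \<and> a \<in> eigenspace g T r \<and>
    (\<exists>i::nat. m = int k - 1 + int i \<and> i + (if r = 0 then 0 else 1) \<le> n)"
proof (cases "r < T")
  case True
  then have r: "0 \<le> real r / real T" "real r / real T < 1" "r \<noteq> 0 \<Longrightarrow> real r / real T > 0"
    using assms by simp_all
  have "real r / real T + of_int m - real n \<le> real k - 1 \<and> real k - 1 \<le> real r / real T + of_int m
      \<longleftrightarrow> (\<exists>i::nat. m = int k - 1 + int i \<and> i + (if r = 0 then 0 else 1) \<le> n)" (is "?l \<longleftrightarrow> ?r")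
  proof
    assume l: ?l
    then have "int k - 1 \<le> m" using r by linarith
    then obtain i where i: "m = int k - 1 + int i" by (metis zle_iff_zadd)
    then have "i + (if r = 0 then 0 else 1) \<le> n" using l r by auto
    with i show ?r by blast
  next
    assume ?r
    then show ?l using r by (auto split: if_splits)
  qed
  then show ?thesis unfolding constrained_def by blast
qed (simp add: constrained_def)

text \<open>Brings the conditions on a block into the shape of the conclusion of
  \<open>residue_relation\<close>.\<close>

lemma restricted_conformal_blocks_residue_iff:
  assumes V: "vertex_operator_algebra V" and g: "voa_automorphism V g" and T: "T \<ge> 1"
    and M: "weak_module V (act_mode M)"
    and lact: "left_zhu_module V g T lact" and ract: "right_zhu_module V g T ract"
  shows "\<phi> \<in> restricted_conformal_blocks V g T M ract lact \<longleftrightarrow> clinear \<phi> \<and>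
    (\<forall>a k r i n u3 v u2.
      r < T \<and> a \<in> wt_space V k \<and> a \<in> eigenspace g T r \<and> i + (if r = 0 then 0 else 1) \<le> n \<longrightarrow>
      \<phi> (u3 \<otimes>\<^sub>C residue (act_mode M) (of_nat k - 1 + of_nat r / of_nat T + of_nat i) (int n) a v \<otimes>\<^sub>C u2)
      = (if r = 0 \<and> i = n then \<phi> (ract u3 (zhu_class V g T a) \<otimes>\<^sub>C v \<otimes>\<^sub>C u2) else 0)
        - (if r = 0 \<and> i = 0 then (-1) ^ n * \<phi> (u3 \<otimes>\<^sub>C v \<otimes>\<^sub>C lact (zhu_class V g T a) u2) else 0))"
    (is "_ \<longleftrightarrow> clinear \<phi> \<and> ?R")
proof (cases "clinear \<phi>")
  case lin: True
  let ?F = "form_action V g T M ract lact"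
  have pure: "(\<forall>t. \<phi> (?F a k r m n t) = 0) \<longleftrightarrow> (\<forall>u3 v u2. \<phi> (?F a k r m n (u3 \<otimes>\<^sub>C v \<otimes>\<^sub>C u2)) = 0)"
    for a k r m n
  proof
    assume *: "\<forall>u3 v u2. \<phi> (?F a k r m n (u3 \<otimes>\<^sub>C v \<otimes>\<^sub>C u2)) = 0"
    have "(\<lambda>t. \<phi> (?F a k r m n t)) = (\<lambda>t. 0)"
      by (rule clinear_tensor_eqI)
        (use * clinear_compose[OF lin form_action_tensor(1)[OF M lact ract]] in \<open>auto simp: clinear_iff\<close>)
    then show "\<forall>t. \<phi> (?F a k r m n t) = 0" by meson
  qed blast
  have val: "\<phi> (?F a k r (int k - 1 + int i) n (u3 \<otimes>\<^sub>C v \<otimes>\<^sub>C u2))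
      = \<phi> (u3 \<otimes>\<^sub>C residue (act_mode M) (of_nat k - 1 + of_nat r / of_nat T + of_nat i) (int n) a v \<otimes>\<^sub>C u2)
        - (if r = 0 \<and> i = n then \<phi> (ract u3 (zhu_class V g T a) \<otimes>\<^sub>C v \<otimes>\<^sub>C u2) else 0)
        + (if r = 0 \<and> i = 0 then (-1) ^ n * \<phi> (u3 \<otimes>\<^sub>C v \<otimes>\<^sub>C lact (zhu_class V g T a) u2) else 0)"
    if "r < T" for a k r i n u3 v u2
  proof -
    let ?m = "int k - 1 + int i" and ?x = "real r / real T"
    have x: "0 \<le> ?x" "?x < 1" "?x = 0 \<longleftrightarrow> r = 0" using that by simp_all
    have "complex_of_real (?x + of_int ?m) = of_nat k - 1 + of_nat r / of_nat T + of_nat i"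
      by simp
    \<comment> \<open>The equation makes r/T an integer in [0,1), hence 0: only untwisted vectors
      act at infinity.\<close>
    moreover have "?x + of_int ?m - real n = real k - 1 \<longleftrightarrow> r = 0 \<and> i = n"
    proof
      assume *: "?x + of_int ?m - real n = real k - 1"
      then have "?x = of_int (int n - int i)" by simp
      with x(1,2) have "int n - int i = 0" by linarith
      with * x(3) show "r = 0 \<and> i = n" by simp
    qed simp
    moreover have "?x + of_int ?m = real k - 1 \<longleftrightarrow> r = 0 \<and> i = 0"
    proof
      assume "?x + of_int ?m = real k - 1"
      then have "?x + real i = 0" by simp
      with x(1) have "?x = 0" "real i = 0" by linarith+
      with x(3) show "r = 0 \<and> i = 0" by simp
    qed simp
    ultimately show ?thesis
      by (simp only: form_action_tensor(2)[OF M lact ract])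
        (simp add: clinear_add[OF lin] clinear_diff[OF lin] clinear_scale[OF lin] clinear_zero[OF lin])
  qed
  have "\<phi> \<in> restricted_conformal_blocks V g T M ract lact \<longleftrightarrow>
    (\<forall>a k r i n u3 v u2.
      r < T \<and> a \<in> wt_space V k \<and> a \<in> eigenspace g T r \<and> i + (if r = 0 then 0 else 1) \<le> n \<longrightarrow>
      \<phi> (?F a k r (int k - 1 + int i) n (u3 \<otimes>\<^sub>C v \<otimes>\<^sub>C u2)) = 0)"
    unfolding restricted_conformal_blocks_iff[OF V g] constrained_iff[OF T]
    using lin pure by metis
  also have "\<dots> \<longleftrightarrow> ?R"
  proof -
    have eq: "x - y + z = 0 \<longleftrightarrow> x = y - z" for x y z :: complex by (auto simp: algebra_simps)
    show ?thesis by (intro all_cong1 imp_cong refl) (simp only: val eq)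
  qed
  finally show ?thesis using lin by simp
qed (simp add: restricted_conformal_blocks_def)

text \<open>Apart from the conformal relation, all generators of \<open>J_space\<close> are residues
  of pole order 1; a generator x - y is read as the equation \<phi> x = \<phi> y.\<close>

lemma coinvariants_iff:
  assumes Y: "weak_module V (act_mode M)"
  shows "\<phi> \<in> quotient_dual (J_space V g T M ract lact h1 h) \<longleftrightarrow> clinear \<phi> \<and>
    (\<forall>u3 v u2.
      \<phi> (u3 \<otimes>\<^sub>C (Lop V (act_mode M) (-1) v + Lop V (act_mode M) 0 v - h1 *\<^sub>C v + h *\<^sub>C v) \<otimes>\<^sub>C u2) = 0 \<and>
      (\<forall>a k. a \<in> wt_space V k \<and> a \<in> eigenspace g T 0 \<longrightarrow>
        \<phi> (ract u3 (zhu_class V g T a) \<otimes>\<^sub>C v \<otimes>\<^sub>C u2)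
          = \<phi> (u3 \<otimes>\<^sub>C residue (act_mode M) (of_nat k) 1 a v \<otimes>\<^sub>C u2) \<and>
        \<phi> (u3 \<otimes>\<^sub>C v \<otimes>\<^sub>C lact (zhu_class V g T a) u2)
          = \<phi> (u3 \<otimes>\<^sub>C residue (act_mode M) (of_nat k - 1) 1 a v \<otimes>\<^sub>C u2)) \<and>
      (\<forall>a k r. r \<noteq> 0 \<and> r < T \<and> a \<in> wt_space V k \<and> a \<in> eigenspace g T r \<longrightarrow>
        \<phi> (u3 \<otimes>\<^sub>C residue (act_mode M) (of_nat k - 1 + of_nat r / of_nat T) 1 a v \<otimes>\<^sub>C u2) = 0))"
proof (cases "clinear \<phi>")
  case True
  have eq: "\<phi> x = \<phi> y \<longleftrightarrow> \<phi> (x - y) = 0" for x y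
    by (simp add: clinear_diff[OF True])
  show ?thesis
    unfolding J_space_def Let_def quotient_dual_span tensor_residue[OF Y, where n = 1] eq
    using True by blast
qed (simp add: J_space_def Let_def quotient_dual_span)

section \<open>Comparison of the two systems of relations\<close>

theorem theorem5:
  fixes V :: "'v::complex_vector voa"
    and g :: "'v \<Rightarrow> 'v" and T :: nat
    and M1 :: "('v, 'm::complex_vector) voa_module"
    and U2 :: "'v set \<Rightarrow> 'u2 \<Rightarrow> 'u2::complex_vector"
    and U3 :: "'u3 \<Rightarrow> 'v set \<Rightarrow> 'u3::complex_vector"
    and h1 h2 h3 h :: complex
  assumes "vertex_operator_algebra V"
    and "voa_automorphism V g" and "T \<ge> 1" and "g ^^ T = id"
    and "admissible_module V M1" and "has_conformal_weight V M1 h1"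
    and "left_zhu_module V g T U2" and "\<And>u. U2 (zhu_class V g T (conf V)) u = h2 *\<^sub>C u"
    and "right_zhu_module V g T U3" and "\<And>u. U3 u (zhu_class V g T (conf V)) = h3 *\<^sub>C u"
    and "h = h1 + h2 - h3"
  shows "restricted_conformal_blocks V g T M1 U3 U2
       = quotient_dual (J_space V g T M1 U3 U2 h1 h)"
proof (intro set_eqI iffI)
  let ?Y = "act_mode M1" and ?cls = "zhu_class V g T"
  have Y: "weak_module V ?Y" using assms(5) unfolding admissible_module_def by blast
  note blocks = restricted_conformal_blocks_residue_iff[OF assms(1-3) Y assms(7,9)]
  \<comment> \<open>The second and third facts give linearity of \<phi> in the middle and in the
    last tensor slot.\<close>
  note lin = clinear_compose[OF _ clinear_tensor_left]
    clinear_compose[OF _ clinear_compose[OF clinear_tensor_left clinear_tensor_right]]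
    clinear_compose[OF _ clinear_tensor_right]
  {
    fix \<phi> assume "\<phi> \<in> restricted_conformal_blocks V g T M1 U3 U2"
    then have \<phi>: "clinear \<phi>"
      and rel: "\<And>a k r i n u3 v u2. r < T \<Longrightarrow> a \<in> wt_space V k \<Longrightarrow> a \<in> eigenspace g T r \<Longrightarrow>
        i + (if r = 0 then 0 else 1) \<le> n \<Longrightarrow>
        \<phi> (u3 \<otimes>\<^sub>C residue ?Y (of_nat k - 1 + of_nat r / of_nat T + of_nat i) (int n) a v \<otimes>\<^sub>C u2)
        = (if r = 0 \<and> i = n then \<phi> (U3 u3 (?cls a) \<otimes>\<^sub>C v \<otimes>\<^sub>C u2) else 0)
          - (if r = 0 \<and> i = 0 then (-1) ^ n * \<phi> (u3 \<otimes>\<^sub>C v \<otimes>\<^sub>C U2 (?cls a) u2) else 0)"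
      unfolding blocks by blast+
    \<comment> \<open>The form \<omega> \<otimes> z dz has r = i = n = 0, so both boundary terms
      occur; they contribute the scalar h3 - h2 = h1 - h.\<close>
    have "\<phi> (u3 \<otimes>\<^sub>C (Lop V ?Y (-1) v + Lop V ?Y 0 v - h1 *\<^sub>C v + h *\<^sub>C v) \<otimes>\<^sub>C u2) = 0" for u3 v u2
    proof -
      have "conf V \<in> wt_space V 2" "conf V \<in> eigenspace g T 0"
        using assms(1,2) unfolding vertex_operator_algebra_def voa_automorphism_def eigenspace_def
        by (simp_all add: scaleC_one)
      then have "\<phi> (u3 \<otimes>\<^sub>C residue ?Y 1 0 (conf V) v \<otimes>\<^sub>C u2)
          = \<phi> (U3 u3 (?cls (conf V)) \<otimes>\<^sub>C v \<otimes>\<^sub>C u2) - \<phi> (u3 \<otimes>\<^sub>C v \<otimes>\<^sub>C U2 (?cls (conf V)) u2)"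
        using rel[of 0 "conf V" 2 0 0 u3 v u2] assms(3) by simp
      also have "residue ?Y 1 0 (conf V) v = Lop V ?Y (-1) v + Lop V ?Y 0 v"
        using residue_pascal[OF Y, of 0 0 "conf V" v] by (simp add: residue_zero_power[OF Y] Lop_def)
      also have "\<phi> (U3 u3 (?cls (conf V)) \<otimes>\<^sub>C v \<otimes>\<^sub>C u2) = h3 * \<phi> (u3 \<otimes>\<^sub>C v \<otimes>\<^sub>C u2)"
        by (simp add: assms(10) clinear_scale[OF clinear_tensor_left] clinear_scale[OF \<phi>])
      also have "\<phi> (u3 \<otimes>\<^sub>C v \<otimes>\<^sub>C U2 (?cls (conf V)) u2) = h2 * \<phi> (u3 \<otimes>\<^sub>C v \<otimes>\<^sub>C u2)"
        by (simp add: assms(8) clinear_scale[OF clinear_tensor_right] clinear_scale[OF \<phi>])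
      finally show ?thesis
        by (simp add: assms(11) clinear_add[OF lin(2)[OF \<phi>]] clinear_diff[OF lin(2)[OF \<phi>]]
          clinear_scale[OF lin(2)[OF \<phi>]] algebra_simps)
    qed
    moreover have "\<phi> (U3 u3 (?cls a) \<otimes>\<^sub>C v \<otimes>\<^sub>C u2) = \<phi> (u3 \<otimes>\<^sub>C residue ?Y (of_nat k) 1 a v \<otimes>\<^sub>C u2)"
      "\<phi> (u3 \<otimes>\<^sub>C v \<otimes>\<^sub>C U2 (?cls a) u2) = \<phi> (u3 \<otimes>\<^sub>C residue ?Y (of_nat k - 1) 1 a v \<otimes>\<^sub>C u2)"
      if "a \<in> wt_space V k" "a \<in> eigenspace g T 0" for u3 v u2 a k
      \<comment> \<open>For n = 1, the choice i = 1 keeps only the action at infinity and i = 0 only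
        the action at zero, there with sign -(-1)^1 = 1.\<close>
      using rel[of 0 a k 1 1 u3 v u2] rel[of 0 a k 0 1 u3 v u2] assms(3) that by simp_all
    moreover have "\<phi> (u3 \<otimes>\<^sub>C residue ?Y (of_nat k - 1 + of_nat r / of_nat T) 1 a v \<otimes>\<^sub>C u2) = 0"
      if "r \<noteq> 0" "r < T" "a \<in> wt_space V k" "a \<in> eigenspace g T r" for u3 v u2 a k r
      using rel[of r a k 0 1 u3 v u2] that by simp
    ultimately show "\<phi> \<in> quotient_dual (J_space V g T M1 U3 U2 h1 h)"
      unfolding coinvariants_iff[OF Y] using \<phi> by blast
  }
  {
    fix \<phi> assume "\<phi> \<in> quotient_dual (J_space V g T M1 U3 U2 h1 h)"
    then have \<phi>: "clinear \<phi>"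
      and right: "\<And>u3 v u2 a k. a \<in> wt_space V k \<Longrightarrow> a \<in> eigenspace g T 0 \<Longrightarrow>
        \<phi> (U3 u3 (?cls a) \<otimes>\<^sub>C v \<otimes>\<^sub>C u2) = \<phi> (u3 \<otimes>\<^sub>C residue ?Y (of_nat k) 1 a v \<otimes>\<^sub>C u2)"
      and left: "\<And>u3 v u2 a k. a \<in> wt_space V k \<Longrightarrow> a \<in> eigenspace g T 0 \<Longrightarrow>
        \<phi> (u3 \<otimes>\<^sub>C v \<otimes>\<^sub>C U2 (?cls a) u2) = \<phi> (u3 \<otimes>\<^sub>C residue ?Y (of_nat k - 1) 1 a v \<otimes>\<^sub>C u2)"
      and twisted: "\<And>u3 v u2 a k r. r \<noteq> 0 \<Longrightarrow> r < T \<Longrightarrow> a \<in> wt_space V k \<Longrightarrow> a \<in> eigenspace g T r \<Longrightarrow>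
        \<phi> (u3 \<otimes>\<^sub>C residue ?Y (of_nat k - 1 + of_nat r / of_nat T) 1 a v \<otimes>\<^sub>C u2) = 0"
      unfolding coinvariants_iff[OF Y] by blast+
    have "\<phi> (u3 \<otimes>\<^sub>C residue ?Y (of_nat k - 1 + of_nat r / of_nat T + of_nat i) (int n) a v \<otimes>\<^sub>C u2)
        = (if r = 0 \<and> i = n then \<phi> (U3 u3 (?cls a) \<otimes>\<^sub>C v \<otimes>\<^sub>C u2) else 0)
          - (if r = 0 \<and> i = 0 then (-1) ^ n * \<phi> (u3 \<otimes>\<^sub>C v \<otimes>\<^sub>C U2 (?cls a) u2) else 0)"
      if a: "r < T" "a \<in> wt_space V k" "a \<in> eigenspace g T r" "i + (if r = 0 then 0 else 1) \<le> n"
      for a k r i n u3 v u2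
    \<comment> \<open>With \<open>u3\<close>, \<open>v\<close> and \<open>u2\<close> fixed, \<alpha>
      and \<beta> are the values of \<phi> after the actions at infinity and at zero. The simple
      pole hypothesis is the left relation of \<open>J_space\<close> for r = 0 and the twisted one
      otherwise.\<close>
    proof (rule residue_relation[where \<psi> = "\<lambda>v. \<phi> (u3 \<otimes>\<^sub>C v \<otimes>\<^sub>C u2)"
          and \<alpha> = "\<lambda>a. \<phi> (U3 u3 (?cls a) \<otimes>\<^sub>C v \<otimes>\<^sub>C u2)" and \<beta> = "\<lambda>a. \<phi> (u3 \<otimes>\<^sub>C v \<otimes>\<^sub>C U2 (?cls a) u2)",
          OF assms(1,2) Y lin(2)[OF \<phi>] _ _ _ a(2-4)])
      fix b l assume b: "b \<in> wt_space V l" "b \<in> eigenspace g T r"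
      show "\<phi> (u3 \<otimes>\<^sub>C residue ?Y (of_nat l - 1 + of_nat r / of_nat T) 1 b v \<otimes>\<^sub>C u2)
          = (if r = 0 then \<phi> (u3 \<otimes>\<^sub>C v \<otimes>\<^sub>C U2 (?cls b) u2) else 0)"
        using left[OF b(1)] twisted[OF _ a(1) b] b(2) by (cases "r = 0") simp_all
    next
      fix b l assume b: "b \<in> wt_space V l" "b \<in> eigenspace g T 0"
      show "\<phi> (u3 \<otimes>\<^sub>C residue ?Y (of_nat l) 1 b v \<otimes>\<^sub>C u2) = \<phi> (U3 u3 (?cls b) \<otimes>\<^sub>C v \<otimes>\<^sub>C u2)"
        using right[OF b] by simp
      have "clinear (\<lambda>a. U2 (?cls a) u2)"
        using assms(7) unfolding left_zhu_module_def cbilinear_def by blast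
      from zhu_class_translation[OF assms(1,3) b, where f = "\<lambda>c. U2 c u2", OF this]
      show "\<phi> (u3 \<otimes>\<^sub>C v \<otimes>\<^sub>C U2 (?cls (Lop V (mode V) (-1) b)) u2)
          = - (of_nat l * \<phi> (u3 \<otimes>\<^sub>C v \<otimes>\<^sub>C U2 (?cls b) u2))"
        by (simp add: clinear_neg[OF lin(3)[OF \<phi>]] clinear_scale[OF lin(3)[OF \<phi>]])
    qed
    then show "\<phi> \<in> restricted_conformal_blocks V g T M1 U3 U2"
      unfolding blocks using \<phi> by blast
  }
qed

end
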